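(* For every $n\in\mathbb{N}$, the natural system of coordinates of the quaternionic projective space $\mathbb{HP}^n$ endows $\mathbb{HP}^n$ with a structure of quaternionic regular manifold; that is, the transition functions between the natural affine charts of $\mathbb{HP}^n$ are slice regular.
   Context: **Slice regularity.** $\mathbb{H}$ is the skew field of quaternions and $\mathbb{S}=\{J\in\mathbb{H}: J^2=-1\}$. Let $D\subseteq\mathbb{C}^n$ be open and invariant under complex conjugation in each variable separately, and let $\Omega_D=\{(q_1,\dots,q_n)\in\mathbb{H}^n: q_h=x_h+y_hJ_h,\ x_h,y_h\in\mathbb{R},\ J_h\in\mathbb{S},\ (x_1+y_1i,\dots,x_n+y_ni)\in D\}$. A $C^1$ stem function on $D$ is a family $F=(F_K)_{K\subseteq\{1,\dots,n\}}$ of $C^1$ functions $F_K:D\to\mathbb{H}$ such that conjugating the variable $z_h$ leaves $F_K$ unchanged if $h\notin K$ and changes $F_K$ to $-F_K$ if $h\in K$. It is holomorphic if for every $h$ and every $K\not\ni h$ one has $\partial F_K/\partial x_h=\partial F_{K\cup\{h\}}/\partial y_h$ and $\partial F_K/\partial y_h=-\partial F_{K\cup\{h\}}/\partial x_h$ on $D$, where $z_h=x_h+iy_h$. A function $f:\Omega_D\to\mathbb{H}$ is left slice regular if for some holomorphic stem function $F$ one has $f(x_1+y_1J_1,\dots,x_n+y_nJ_n)=\sum_K J_{k_1}J_{k_2}\cdots J_{k_s}\,F_K(x_1+y_1i,\dots,x_n+y_ni)$, where $K=\{k_1<\dots<k_s\}$; it is right slice regular if for some holomorphic stem function $F$ one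 has $f(x_1+y_1J_1,\dots,x_n+y_nJ_n)=\sum_K F_K(x_1+y_1i,\dots,x_n+y_ni)\,J_{k_s}\cdots J_{k_2}J_{k_1}$ (for example $q_1q_2$ is left slice regular and $q_2q_1$ is right slice regular). A differentiable map $\Omega_D\to\mathbb{H}^m$ is slice regular if each of its components is either left or right slice regular. **Quaternionic regular manifolds.** A differentiable manifold of real dimension $4n$ is quaternionic regular if it admits a differentiable atlas $\{(U_i,\varphi_i)\}$, $\varphi_i:U_i\to\mathbb{H}^n$, all of whose transition functions $\varphi_j\circ\varphi_i^{-1}:\varphi_i(U_i\cap U_j)\to\varphi_j(U_i\cap U_j)$ are slice regular. **Projective space.** $\mathbb{HP}^n$ is the set of right vector lines $[a_1,\dots,a_{n+1}]=\{(a_1\lambda,\dots,a_{n+1}\lambda):\lambda\in\mathbb{H}\}$ of $\mathbb{H}^{n+1}$. Its natural charts are $U_i=\{[a]: a_i\neq0\}$, $p_i([a])=(a_1a_i^{-1},\dots,a_{i-1}a_i^{-1},a_{i+1}a_i^{-1},\dots,a_{n+1}a_i^{-1})\in\mathbb{H}^n$, for $i=1,\dots,n+1$. *)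

theory Defs
  imports "HOL-Analysis.Analysis"
begin

section \<open>Quaternions\<close>

datatype quat = Quat (qRe: real) (qIm1: real) (qIm2: real) (qIm3: real)

lemma quat_eq_iff:
  "p = q \<longleftrightarrow> qRe p = qRe q \<and> qIm1 p = qIm1 q \<and> qIm2 p = qIm2 q \<and> qIm3 p = qIm3 q"
  by (cases p; cases q) simp

instantiation quat :: ring_1
begin

definition "0 = Quat 0 0 0 0"
definition "1 = Quat 1 0 0 0"
definition "p + q = Quat (qRe p + qRe q) (qIm1 p + qIm1 q) (qIm2 p + qIm2 q) (qIm3 p + qIm3 q)"
definition "- p = Quat (- qRe p) (- qIm1 p) (- qIm2 p) (- qIm3 p)"
definition "p - q = Quat (qRe p - qRe q) (qIm1 p - qIm1 q) (qIm2 p - qIm2 q) (qIm3 p - qIm3 q)"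
definition "p * q = Quat
  (qRe p * qRe q - qIm1 p * qIm1 q - qIm2 p * qIm2 q - qIm3 p * qIm3 q)
  (qRe p * qIm1 q + qIm1 p * qRe q + qIm2 p * qIm3 q - qIm3 p * qIm2 q)
  (qRe p * qIm2 q - qIm1 p * qIm3 q + qIm2 p * qRe q + qIm3 p * qIm1 q)
  (qRe p * qIm3 q + qIm1 p * qIm2 q - qIm2 p * qIm1 q + qIm3 p * qRe q)"

instance
  by standard
    (simp_all add: quat_eq_iff zero_quat_def one_quat_def plus_quat_def uminus_quat_def
      minus_quat_def times_quat_def algebra_simps)

end

instantiation quat :: real_algebra_1
begin

definition "scaleR r q = Quat (r * qRe q) (r * qIm1 q) (r * qIm2 q) (r * qIm3 q)"

instance
  by standard
    (simp_all add: quat_eq_iff scaleR_quat_def plus_quat_def times_quat_def algebra_simps)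

end

lemma quat_component_simps [simp]:
  "qRe 0 = 0" "qIm1 0 = 0" "qIm2 0 = 0" "qIm3 0 = 0"
  "qRe 1 = 1" "qIm1 1 = 0" "qIm2 1 = 0" "qIm3 1 = 0"
  "qRe (p + q) = qRe p + qRe q" "qIm1 (p + q) = qIm1 p + qIm1 q"
  "qIm2 (p + q) = qIm2 p + qIm2 q" "qIm3 (p + q) = qIm3 p + qIm3 q"
  "qRe (- p) = - qRe p" "qIm1 (- p) = - qIm1 p" "qIm2 (- p) = - qIm2 p" "qIm3 (- p) = - qIm3 p"
  "qRe (p - q) = qRe p - qRe q" "qIm1 (p - q) = qIm1 p - qIm1 q"
  "qIm2 (p - q) = qIm2 p - qIm2 q" "qIm3 (p - q) = qIm3 p - qIm3 q"
  "qRe (r *\<^sub>R q) = r * qRe q" "qIm1 (r *\<^sub>R q) = r * qIm1 q"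
  "qIm2 (r *\<^sub>R q) = r * qIm2 q" "qIm3 (r *\<^sub>R q) = r * qIm3 q"
  by (simp_all add: zero_quat_def one_quat_def plus_quat_def uminus_quat_def minus_quat_def
      scaleR_quat_def)

instantiation quat :: real_inner
begin

definition "inner p q = qRe p * qRe q + qIm1 p * qIm1 q + qIm2 p * qIm2 q + qIm3 p * qIm3 q"
definition "norm q = sqrt (inner q (q :: quat))"
definition "sgn q = q /\<^sub>R norm (q :: quat)"
definition "dist p q = norm (p - q :: quat)"
definition [code del]:
  "(uniformity :: (quat \<times> quat) filter) = (INF e\<in>{0<..}. principal {(x, y). dist x y < e})"
definition [code del]:
  "open (U :: quat set) \<longleftrightarrow> (\<forall>x\<in>U. eventually (\<lambda>(x', y). x' = x \<longrightarrow> y \<in> U) uniformity)"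

instance
proof
  fix p q s :: quat and r :: real
  show "inner p q = inner q p" and "inner (p + q) s = inner p s + inner q s"
    and "inner (r *\<^sub>R p) q = r * inner p q"
    by (simp_all add: inner_quat_def algebra_simps)
  show nonneg: "0 \<le> inner p p"
    by (simp add: inner_quat_def)
  show "inner p p = 0 \<longleftrightarrow> p = 0"
    by (auto simp: inner_quat_def quat_eq_iff add_nonneg_eq_0_iff)
qed (rule norm_quat_def sgn_quat_def dist_quat_def uniformity_quat_def open_quat_def)+

end

instantiation quat :: euclidean_space
begin

definition "Basis = {Quat 1 0 0 0, Quat 0 1 0 0, Quat 0 0 1 0, Quat 0 0 0 1}"

instance
proof
  show "(Basis :: quat set) \<noteq> {}" and "finite (Basis :: quat set)"
    by (simp_all add: Basis_quat_def)
  fix u v :: quat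
  assume "u \<in> Basis" "v \<in> Basis"
  then show "inner u v = (if u = v then 1 else 0)"
    unfolding Basis_quat_def insert_iff empty_iff by (elim disjE) (simp_all add: inner_quat_def)
next
  fix x :: quat
  show "(\<forall>u\<in>Basis. inner x u = 0) \<longleftrightarrow> x = 0"
    by (simp add: Basis_quat_def inner_quat_def zero_quat_def) (cases x, simp)
qed

end

instantiation quat :: real_normed_div_algebra
begin

definition "inverse q =
  (1 / (norm q)\<^sup>2) *\<^sub>R Quat (qRe q) (- qIm1 q) (- qIm2 q) (- qIm3 q)"
definition "p div q = p * inverse (q :: quat)"

instance
proof
  fix p q :: quat
  have sq: "(norm x)\<^sup>2 = (qRe x)\<^sup>2 + (qIm1 x)\<^sup>2 + (qIm2 x)\<^sup>2 + (qIm3 x)\<^sup>2" for x :: quat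
    unfolding power2_norm_eq_inner by (simp add: inner_quat_def power2_eq_square)
  have "(norm (p * q))\<^sup>2 = (norm p * norm q)\<^sup>2"
    unfolding power_mult_distrib sq times_quat_def quat.sel by algebra
  then show "norm (p * q) = norm p * norm q"
    by (rule power2_eq_imp_eq) simp_all
  show "p div q = p * inverse q"
    by (fact divide_quat_def)
  show "inverse (0 :: quat) = 0"
    by (simp add: inverse_quat_def)
  assume "p \<noteq> 0"
  then have n: "(norm p)\<^sup>2 \<noteq> 0"
    by simp
  have conj: "Quat (qRe p) (- qIm1 p) (- qIm2 p) (- qIm3 p) * p = (norm p)\<^sup>2 *\<^sub>R 1"
    "p * Quat (qRe p) (- qIm1 p) (- qIm2 p) (- qIm3 p) = (norm p)\<^sup>2 *\<^sub>R 1"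
    unfolding sq by (simp_all add: quat_eq_iff times_quat_def power2_eq_square)
  show "inverse p * p = 1" and "p * inverse p = 1"
    using n unfolding inverse_quat_def mult_scaleR_left mult_scaleR_right conj by simp_all
qed

end

definition imaginary_units :: "quat set"  \<comment> \<open>the sphere S of imaginary units\<close>
  where "imaginary_units = {J. J\<^sup>2 = - 1}"


section \<open>Coordinate spaces and differentiability\<close>

text \<open>
  Points of \<open>\<complex>\<^sup>n\<close> and \<open>\<H>\<^sup>n\<close> are functions on \<open>{1..n}\<close> (extensional, i.e. \<open>undefined\<close>
  elsewhere), so that \<open>n\<close> can be quantified over and the indices keep their order.
\<close>

definition cspace :: "nat \<Rightarrow> (nat \<Rightarrow> 'a::topological_space) topology"
  where "cspace n = product_topology (\<lambda>_. euclidean) {1..n}"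

lemma topspace_cspace: "topspace (cspace n) = ({1..n} \<rightarrow>\<^sub>E UNIV)"
  by (simp add: cspace_def)

text \<open>
  Partial derivative in the \<open>h\<close>-th variable in the real direction \<open>w\<close>. For complex variables
  \<open>w = 1\<close> and \<open>w = \<i>\<close> give the derivatives in \<open>x\<^sub>h\<close> and \<open>y\<^sub>h\<close>.
\<close>

definition has_partial_deriv ::
    "nat \<Rightarrow> 'a::real_normed_vector \<Rightarrow> ((nat \<Rightarrow> 'a) \<Rightarrow> 'b::real_normed_vector) \<Rightarrow> (nat \<Rightarrow> 'a) \<Rightarrow> bool"
  where "has_partial_deriv h w f z \<longleftrightarrow> (\<lambda>t::real. f (z(h := z h + t *\<^sub>R w))) differentiable (at 0)"

definition partial_deriv ::
    "nat \<Rightarrow> 'a::real_normed_vector \<Rightarrow> ((nat \<Rightarrow> 'a) \<Rightarrow> 'b::real_normed_vector) \<Rightarrow> (nat \<Rightarrow> 'a) \<Rightarrow> 'b"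
  where "partial_deriv h w f z = vector_derivative (\<lambda>t::real. f (z(h := z h + t *\<^sub>R w))) (at 0)"

text \<open>\<open>C\<^sup>k\<close> functions on an open set \<open>X\<close>: all real partial derivatives of order at most \<open>k\<close>
  exist and are continuous on \<open>X\<close>.\<close>

primrec Ck_on ::
    "nat \<Rightarrow> nat \<Rightarrow> (nat \<Rightarrow> 'a::euclidean_space) set \<Rightarrow> ((nat \<Rightarrow> 'a) \<Rightarrow> 'b::real_normed_vector) \<Rightarrow> bool"
  where
    "Ck_on n 0 X f \<longleftrightarrow> continuous_map (subtopology (cspace n) X) euclidean f"
  | "Ck_on n (Suc k) X f \<longleftrightarrow>
       continuous_map (subtopology (cspace n) X) euclidean f \<and>
       (\<forall>h\<in>{1..n}. \<forall>w\<in>Basis. (\<forall>z\<in>X. has_partial_deriv h w f z) \<and> Ck_on n k X (partial_deriv h w f))"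

definition smooth_map_on ::
    "nat \<Rightarrow> nat \<Rightarrow> (nat \<Rightarrow> quat) set \<Rightarrow> ((nat \<Rightarrow> quat) \<Rightarrow> (nat \<Rightarrow> quat)) \<Rightarrow> bool"
  where "smooth_map_on n m X f \<longleftrightarrow>
    f \<in> X \<rightarrow> ({1..m} \<rightarrow>\<^sub>E UNIV) \<and> (\<forall>l\<in>{1..m}. \<forall>k. Ck_on n k X (\<lambda>q. f q l))"


section \<open>Slice regular functions\<close>

definition conj_invariant :: "nat \<Rightarrow> (nat \<Rightarrow> complex) set \<Rightarrow> bool"
  where "conj_invariant n D \<longleftrightarrow> (\<forall>h\<in>{1..n}. \<forall>z\<in>D. z(h := cnj (z h)) \<in> D)"

definition cpoint :: "nat \<Rightarrow> (nat \<Rightarrow> real) \<Rightarrow> (nat \<Rightarrow> real) \<Rightarrow> (nat \<Rightarrow> complex)"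
  where "cpoint n x y = (\<lambda>h\<in>{1..n}. Complex (x h) (y h))"

definition qpoint ::
    "nat \<Rightarrow> (nat \<Rightarrow> real) \<Rightarrow> (nat \<Rightarrow> real) \<Rightarrow> (nat \<Rightarrow> quat) \<Rightarrow> (nat \<Rightarrow> quat)"
  where "qpoint n x y J = (\<lambda>h\<in>{1..n}. of_real (x h) + of_real (y h) * J h)"

definition Omega :: "nat \<Rightarrow> (nat \<Rightarrow> complex) set \<Rightarrow> (nat \<Rightarrow> quat) set"
  where "Omega n D =
    {qpoint n x y J | x y J. (\<forall>h\<in>{1..n}. J h \<in> imaginary_units) \<and> cpoint n x y \<in> D}"

definition C1_stem_function ::
    "nat \<Rightarrow> (nat \<Rightarrow> complex) set \<Rightarrow> (nat set \<Rightarrow> (nat \<Rightarrow> complex) \<Rightarrow> quat) \<Rightarrow> bool"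
  where "C1_stem_function n D F \<longleftrightarrow>
    (\<forall>K. K \<subseteq> {1..n} \<longrightarrow>
       Ck_on n 1 D (F K) \<and>
       (\<forall>h\<in>{1..n}. \<forall>z\<in>D. F K (z(h := cnj (z h))) = (if h \<in> K then - F K z else F K z)))"

definition holomorphic_stem_function ::
    "nat \<Rightarrow> (nat \<Rightarrow> complex) set \<Rightarrow> (nat set \<Rightarrow> (nat \<Rightarrow> complex) \<Rightarrow> quat) \<Rightarrow> bool"
  where "holomorphic_stem_function n D F \<longleftrightarrow>
    C1_stem_function n D F \<and>
    (\<forall>h\<in>{1..n}. \<forall>K. K \<subseteq> {1..n} \<and> h \<notin> K \<longrightarrow> (\<forall>z\<in>D.
       partial_deriv h 1 (F K) z = partial_deriv h \<i> (F (insert h K)) z \<and>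
       partial_deriv h \<i> (F K) z = - partial_deriv h 1 (F (insert h K)) z))"

definition left_slice_regular ::
    "nat \<Rightarrow> (nat \<Rightarrow> complex) set \<Rightarrow> ((nat \<Rightarrow> quat) \<Rightarrow> quat) \<Rightarrow> bool"
  where "left_slice_regular n D f \<longleftrightarrow>
    (\<exists>F. holomorphic_stem_function n D F \<and>
      (\<forall>x y J. (\<forall>h\<in>{1..n}. J h \<in> imaginary_units) \<and> cpoint n x y \<in> D \<longrightarrow>
        f (qpoint n x y J) =
          (\<Sum>K\<in>Pow {1..n}. prod_list (map J (sorted_list_of_set K)) * F K (cpoint n x y))))"

definition right_slice_regular ::
    "nat \<Rightarrow> (nat \<Rightarrow> complex) set \<Rightarrow> ((nat \<Rightarrow> quat) \<Rightarrow> quat) \<Rightarrow> bool"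
  where "right_slice_regular n D f \<longleftrightarrow>
    (\<exists>F. holomorphic_stem_function n D F \<and>
      (\<forall>x y J. (\<forall>h\<in>{1..n}. J h \<in> imaginary_units) \<and> cpoint n x y \<in> D \<longrightarrow>
        f (qpoint n x y J) =
          (\<Sum>K\<in>Pow {1..n}. F K (cpoint n x y) * prod_list (map J (rev (sorted_list_of_set K))))))"

text \<open>
  A slice regular map on \<open>X\<close> with values in \<open>\<H>\<^sup>m\<close>. The set \<open>D\<close> is determined by \<open>X = Omega n D\<close>,
  and \<open>differentiable\<close> is read as \<open>C\<^sup>\<infinity>\<close>, as for atlases below.
\<close>

definition slice_regular_map ::
    "nat \<Rightarrow> nat \<Rightarrow> (nat \<Rightarrow> quat) set \<Rightarrow> ((nat \<Rightarrow> quat) \<Rightarrow> (nat \<Rightarrow> quat)) \<Rightarrow> bool"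
  where "slice_regular_map n m X f \<longleftrightarrow>
    (\<exists>D. openin (cspace n) D \<and> conj_invariant n D \<and> X = Omega n D \<and>
      smooth_map_on n m X f \<and>
      (\<forall>l\<in>{1..m}. left_slice_regular n D (\<lambda>q. f q l) \<or> right_slice_regular n D (\<lambda>q. f q l)))"


section \<open>Quaternionic regular manifolds\<close>

text \<open>A chart is a pair of its domain and its coordinate map, the latter with values in \<open>\<H>\<^sup>n\<close>.\<close>

type_synonym 'p chart = "'p set \<times> ('p \<Rightarrow> nat \<Rightarrow> quat)"

definition chart_on :: "nat \<Rightarrow> 'p topology \<Rightarrow> 'p chart \<Rightarrow> bool"
  where "chart_on n M = (\<lambda>(U, \<phi>).
    openin M U \<and> openin (cspace n) (\<phi> ` U) \<and>
    homeomorphic_map (subtopology M U) (subtopology (cspace n) (\<phi> ` U)) \<phi>)"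

definition transition_domain :: "'p chart \<Rightarrow> 'p chart \<Rightarrow> (nat \<Rightarrow> quat) set"
  where "transition_domain = (\<lambda>(U, \<phi>) (V, \<psi>). \<phi> ` (U \<inter> V))"

definition transition_map :: "'p chart \<Rightarrow> 'p chart \<Rightarrow> (nat \<Rightarrow> quat) \<Rightarrow> (nat \<Rightarrow> quat)"
  where "transition_map = (\<lambda>(U, \<phi>) (V, \<psi>). \<psi> \<circ> inv_into U \<phi>)"

definition differentiable_atlas :: "nat \<Rightarrow> 'p topology \<Rightarrow> 'p chart set \<Rightarrow> bool"
  where "differentiable_atlas n M A \<longleftrightarrow>
    (\<forall>c\<in>A. chart_on n M c) \<and> \<Union> (fst ` A) = topspace M \<and>
    (\<forall>c\<in>A. \<forall>d\<in>A. smooth_map_on n n (transition_domain c d) (transition_map c d))"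

definition quaternionic_regular_atlas :: "nat \<Rightarrow> 'p topology \<Rightarrow> 'p chart set \<Rightarrow> bool"
  where "quaternionic_regular_atlas n M A \<longleftrightarrow>
    differentiable_atlas n M A \<and>
    (\<forall>c\<in>A. \<forall>d\<in>A. slice_regular_map n n (transition_domain c d) (transition_map c d))"

text \<open>The real dimension is \<open>4 * n\<close>; the differentiable structure is the one given by the atlas.\<close>

definition quaternionic_regular_manifold :: "nat \<Rightarrow> 'p topology \<Rightarrow> bool"
  where "quaternionic_regular_manifold n M \<longleftrightarrow>
    Hausdorff_space M \<and> second_countable M \<and> (\<exists>A. quaternionic_regular_atlas n M A)"


section \<open>Quaternionic projective space\<close>

definition punctured_space :: "nat \<Rightarrow> (nat \<Rightarrow> quat) set"  \<comment> \<open>nonzero vectors of \<open>\<H>\<^sup>n\<^sup>+\<^sup>1\<close>\<close>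
  where "punctured_space n = {a \<in> {1..n + 1} \<rightarrow>\<^sub>E UNIV. \<exists>h\<in>{1..n + 1}. a h \<noteq> 0}"

definition right_line :: "nat \<Rightarrow> (nat \<Rightarrow> quat) \<Rightarrow> (nat \<Rightarrow> quat) set"
  where "right_line n a = {(\<lambda>h\<in>{1..n + 1}. a h * c) | c. True}"

definition HP :: "nat \<Rightarrow> (nat \<Rightarrow> quat) set set"
  where "HP n = right_line n ` punctured_space n"

text \<open>The quotient topology; cf. lemma \<open>quotient_map_HP\<close> below.\<close>

definition HP_space :: "nat \<Rightarrow> (nat \<Rightarrow> quat) set topology"
  where "HP_space n = topology (\<lambda>U. U \<subseteq> HP n \<and>
    openin (subtopology (cspace (n + 1)) (punctured_space n))
      {a \<in> punctured_space n. right_line n a \<in> U})"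

definition natural_domain :: "nat \<Rightarrow> nat \<Rightarrow> (nat \<Rightarrow> quat) set set"
  where "natural_domain n i = {right_line n a | a. a \<in> punctured_space n \<and> a i \<noteq> 0}"

text \<open>The coordinates \<open>a\<^sub>h a\<^sub>i\<^sup>-\<^sup>1\<close>, \<open>h \<noteq> i\<close>, of a line, in increasing order of \<open>h\<close>. They do not depend on
  the chosen representative \<open>a\<close>, see lemma \<open>natural_coords_right_line\<close>.\<close>

definition natural_coords :: "nat \<Rightarrow> nat \<Rightarrow> (nat \<Rightarrow> quat) set \<Rightarrow> (nat \<Rightarrow> quat)"
  where "natural_coords n i L =
    (let a = (SOME a. a \<in> punctured_space n \<and> L = right_line n a)
     in (\<lambda>k\<in>{1..n}. a (if k < i then k else k + 1) * inverse (a i)))"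

definition natural_chart :: "nat \<Rightarrow> nat \<Rightarrow> (nat \<Rightarrow> quat) set chart"
  where "natural_chart n i = (natural_domain n i, natural_coords n i)"

lemma openin_HP_space:
  "openin (HP_space n) U \<longleftrightarrow> U \<subseteq> HP n \<and>
    openin (subtopology (cspace (n + 1)) (punctured_space n))
      {a \<in> punctured_space n. right_line n a \<in> U}" (is "_ \<longleftrightarrow> ?P U")
proof -
  let ?T = "subtopology (cspace (n + 1)) (punctured_space n)"
  let ?pre = "\<lambda>U. {a \<in> punctured_space n. right_line n a \<in> U}"
  have "istopology ?P"
    unfolding istopology_def
  proof (intro conjI allI impI)
    fix S T assume S: "?P S" and T: "?P T"
    show "S \<inter> T \<subseteq> HP n"
      using S by blast
    have "?pre (S \<inter> T) = ?pre S \<inter> ?pre T"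
      by blast
    then show "openin ?T (?pre (S \<inter> T))"
      by (simp only: openin_Int conjunct2 [OF S] conjunct2 [OF T])
  next
    fix \<K> assume K: "\<forall>K\<in>\<K>. ?P K"
    show "\<Union>\<K> \<subseteq> HP n"
      using K by blast
    have "openin ?T (\<Union> (?pre ` \<K>))"
    proof (rule openin_Union)
      fix V assume "V \<in> ?pre ` \<K>"
      then obtain U where "U \<in> \<K>" "V = ?pre U"
        by (rule imageE)
      then show "openin ?T V"
        using K by simp
    qed
    moreover have "?pre (\<Union>\<K>) = \<Union> (?pre ` \<K>)"
      by blast
    ultimately show "openin ?T (?pre (\<Union>\<K>))"
      by (simp only:)
  qed
  then have "openin (HP_space n) = ?P"
    unfolding HP_space_def by (rule topology_inverse')
  then show ?thesis
    by (rule fun_cong)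
qed

lemma topspace_punctured:
  "topspace (subtopology (cspace (n + 1)) (punctured_space n)) = punctured_space n"
  unfolding topspace_subtopology topspace_cspace punctured_space_def by blast

lemma topspace_HP_space: "topspace (HP_space n) = HP n"
proof -
  let ?T = "subtopology (cspace (n + 1)) (punctured_space n)"
  have pre: "{a \<in> punctured_space n. right_line n a \<in> HP n} = punctured_space n"
    unfolding HP_def by blast
  have "openin ?T (punctured_space n)"
    using openin_topspace [of ?T] unfolding topspace_punctured .
  then have "openin (HP_space n) (HP n)"
    unfolding openin_HP_space pre by blast
  moreover have "topspace (HP_space n) \<subseteq> HP n"
    using openin_topspace [of "HP_space n"] unfolding openin_HP_space by (rule conjunct1)
  ultimately show ?thesis
    using openin_subset subset_antisym by blast
qed

lemma quotient_map_HP: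
  "quotient_map (subtopology (cspace (n + 1)) (punctured_space n)) (HP_space n) (right_line n)"
  unfolding quotient_map_def topspace_punctured topspace_HP_space
  by (simp only: HP_def [symmetric] openin_HP_space) blast

lemma natural_coords_right_line:
  assumes a: "a \<in> punctured_space n" and i: "i \<in> {1..n + 1}" "a i \<noteq> 0"
  shows "natural_coords n i (right_line n a) =
    (\<lambda>k\<in>{1..n}. a (if k < i then k else k + 1) * inverse (a i))"
proof -
  define b where "b = (SOME b. b \<in> punctured_space n \<and> right_line n a = right_line n b)"
  have b: "b \<in> punctured_space n \<and> right_line n a = right_line n b"
    unfolding b_def by (rule someI [of _ a]) (use a in simp)
  have "(\<lambda>h\<in>{1..n + 1}. b h * 1) \<in> right_line n b"
    unfolding right_line_def by blast
  then obtain c where c: "(\<lambda>h\<in>{1..n + 1}. b h * 1) = (\<lambda>h\<in>{1..n + 1}. a h * c)"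
    using b unfolding right_line_def by blast
  have bc: "b h = a h * c" if "h \<in> {1..n + 1}" for h
    using fun_cong [OF c, of h] that by (simp only: restrict_apply if_True mult_1_right)
  obtain h where h: "h \<in> {1..n + 1}" "b h \<noteq> 0"
    using b unfolding punctured_space_def by blast
  have "c \<noteq> 0"
    using bc [OF h(1)] h(2) by (metis mult_zero_right)
  have quot: "b h * inverse (b i) = a h * inverse (a i)" if "h \<in> {1..n + 1}" for h
  proof -
    have "b h * inverse (b i) = a h * (c * inverse c) * inverse (a i)"
      unfolding bc [OF that] bc [OF i(1)] nonzero_inverse_mult_distrib [OF i(2) \<open>c \<noteq> 0\<close>]
      by (simp only: mult.assoc)
    then show ?thesis
      using \<open>c \<noteq> 0\<close> by simp
  qed
  show ?thesis
    unfolding natural_coords_def Let_def b_def [symmetric]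
  proof (rule restrict_ext)
    fix k assume "k \<in> {1..n}"
    then have "(if k < i then k else k + 1) \<in> {1..n + 1}"
      by simp
    then show "b (if k < i then k else k + 1) * inverse (b i) =
        a (if k < i then k else k + 1) * inverse (a i)"
      by (rule quot)
  qed
qed

end

theory Submission
  imports Defs
begin

text \<open>
  In the coordinates of the \<open>i\<close>-th chart, every component of a transition map of \<open>\<H>\<P>\<^sup>n\<close> has the form
  \<open>q\<^sub>l q\<^sub>m\<^sup>-\<^sup>1\<close> with \<open>l \<noteq> m\<close>, where \<open>q\<^sub>0 = 1\<close>. Both factors are induced by functions of one complex
  variable that commute with conjugation, hence have the form \<open>Re \<phi>(z) + Im \<phi>(z) J\<close> on the slice of \<open>J\<close>.
  Expanding the product of such factors over distinct variables, taken in increasing (decreasing) order of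
  the variables, gives exactly the sum over \<open>K\<close> in the definition of left (right) slice regularity, with
  the real-valued stem function \<open>F\<^sub>K = \<Prod>\<^sub>h (Re or Im) \<phi>\<^sub>h(z\<^sub>h)\<close>. So \<open>q\<^sub>l q\<^sub>m\<^sup>-\<^sup>1\<close> is left slice regular if
  \<open>l < m\<close> and right slice regular if \<open>l > m\<close>.
\<close>

section \<open>Functions of class \<open>C\<^sup>k\<close>\<close>

lemma continuous_map_mult:
  fixes f g :: "'a \<Rightarrow> 'b::real_normed_algebra"
  assumes "continuous_map X euclidean f" "continuous_map X euclidean g"
  shows "continuous_map X euclidean (\<lambda>x. f x * g x)"
  using assms by (simp add: continuous_map_atin tendsto_mult)

lemma continuous_map_inverse:
  fixes f :: "'a \<Rightarrow> 'b::real_normed_div_algebra"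
  assumes "continuous_map X euclidean f" "\<And>x. x \<in> topspace X \<Longrightarrow> f x \<noteq> 0"
  shows "continuous_map X euclidean (\<lambda>x. inverse (f x))"
  using assms by (simp add: continuous_map_atin tendsto_inverse)

lemma continuous_map_bounded_linear:
  assumes "bounded_linear L" "continuous_map X euclidean f"
  shows "continuous_map X euclidean (\<lambda>x. L (f x))"
  using assms by (simp add: continuous_map_atin bounded_linear.tendsto)

lemma continuous_map_cspace_proj:
  "h \<in> {1..n} \<Longrightarrow> continuous_map (cspace n) euclidean (\<lambda>z. z h)"
  unfolding cspace_def by (rule continuous_map_product_projection)

lemma continuous_map_into_cspace:
  "continuous_map X (cspace n) f \<longleftrightarrow>
    f ` topspace X \<subseteq> extensional {1..n} \<and> (\<forall>h\<in>{1..n}. continuous_map X euclidean (\<lambda>x. f x h))"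
  unfolding cspace_def by (rule continuous_map_componentwise)

section \<open>Partial derivatives on open sets\<close>

text \<open>A relational form that names the value of the partial derivative, so that the rules for
  \<open>has_vector_derivative\<close> apply directly.\<close>

definition has_partial_vderiv ::
    "nat \<Rightarrow> 'a::real_normed_vector \<Rightarrow> ((nat \<Rightarrow> 'a) \<Rightarrow> 'b::real_normed_vector) \<Rightarrow> 'b \<Rightarrow> (nat \<Rightarrow> 'a) \<Rightarrow> bool"
  where "has_partial_vderiv h w f D z \<longleftrightarrow>
    ((\<lambda>t::real. f (z(h := z h + t *\<^sub>R w))) has_vector_derivative D) (at 0)"

lemma has_partial_vderiv_imp:
  assumes "has_partial_vderiv h w f D z"
  shows "has_partial_deriv h w f z" "partial_deriv h w f z = D"
  using assms unfolding has_partial_vderiv_def has_partial_deriv_def partial_deriv_def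
  by (auto intro: differentiableI_vector vector_derivative_at)

lemma has_partial_deriv_works:
  "has_partial_deriv h w f z \<longleftrightarrow> has_partial_vderiv h w f (partial_deriv h w f z) z"
  unfolding has_partial_vderiv_def has_partial_deriv_def partial_deriv_def
  by (rule vector_derivative_works)

text \<open>Since \<open>h\<close> is one of the coordinates, the line through \<open>z\<close>
  stays extensional and is continuous into the product topology; the preimage of \<open>X\<close> is
  therefore an open neighbourhood of 0. Hence partial derivatives on \<open>X\<close> depend only on
  values in \<open>X\<close>.\<close>

lemma eventually_line_in_open:
  fixes z :: "nat \<Rightarrow> 'a::real_normed_vector"
  assumes X: "openin (cspace n) X" "z \<in> X" and h: "h \<in> {1..n}"
  shows "\<forall>\<^sub>F t in nhds (0::real). z(h := z h + t *\<^sub>R w) \<in> X"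
proof -
  have z: "z \<in> extensional {1..n}"
    using openin_subset[OF X(1)] X(2) by (auto simp: topspace_cspace PiE_def)
  have "continuous_map euclidean (cspace n) (\<lambda>t::real. z(h := z h + t *\<^sub>R w))"
    unfolding continuous_map_into_cspace
  proof (intro conjI ballI)
    show "(\<lambda>t. z(h := z h + t *\<^sub>R w)) ` topspace euclidean \<subseteq> extensional {1..n}"
      using z h by (auto simp: extensional_def)
    fix k
    show "continuous_map euclidean euclidean (\<lambda>t. (z(h := z h + t *\<^sub>R w)) k)"
      by (cases "k = h") (auto intro!: continuous_intros)
  qed
  from openin_continuous_map_preimage[OF this X(1)]
  have "open {t. z(h := z h + t *\<^sub>R w) \<in> X}"
    by simp
  moreover have "0 \<in> {t. z(h := z h + t *\<^sub>R w) \<in> X}"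
    using X(2) by simp
  ultimately show ?thesis
    unfolding eventually_nhds by blast
qed

lemma has_partial_vderiv_cong:
  assumes X: "openin (cspace n) X" "z \<in> X" and h: "h \<in> {1..n}"
    and eq: "\<And>x. x \<in> X \<Longrightarrow> f x = g x" and f: "has_partial_vderiv h w f D z"
  shows "has_partial_vderiv h w g D z"
proof -
  have "\<forall>\<^sub>F t in nhds 0. f (z(h := z h + t *\<^sub>R w)) = g (z(h := z h + t *\<^sub>R w))"
    using eventually_line_in_open[OF X h] by (rule eventually_mono) (rule eq)
  then have "((\<lambda>t. f (z(h := z h + t *\<^sub>R w))) has_vector_derivative D) (at 0) \<longleftrightarrow>
      ((\<lambda>t. g (z(h := z h + t *\<^sub>R w))) has_vector_derivative D) (at 0)"
    by (intro has_vector_derivative_cong_ev) (auto simp: eq X)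
  with f show ?thesis
    unfolding has_partial_vderiv_def by blast
qed

lemma Ck_on_imp_continuous: "Ck_on n k X f \<Longrightarrow> continuous_map (subtopology (cspace n) X) euclidean f"
  by (cases k) auto

text \<open>Functions that agree on the open set have the same partial derivatives there. The
  induction varies both functions because its hypothesis is applied to these derivatives.\<close>

lemma Ck_on_cong:
  assumes X: "openin (cspace n) X" and "\<And>z. z \<in> X \<Longrightarrow> f z = g z" and "Ck_on n k X f"
  shows "Ck_on n k X g"
  using assms(2,3)
proof (induction k arbitrary: f g)
  case 0
  have "continuous_map (subtopology (cspace n) X) euclidean g"
    by (rule continuous_map_eq[OF Ck_on_imp_continuous[OF 0(2)]]) (simp add: 0(1))
  then show ?case
    by simp
next
  case (Suc k)
  have "continuous_map (subtopology (cspace n) X) euclidean g"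
    by (rule continuous_map_eq[OF Ck_on_imp_continuous[OF Suc.prems(2)]]) (simp add: Suc.prems(1))
  moreover have "(\<forall>z\<in>X. has_partial_deriv h w g z) \<and> Ck_on n k X (partial_deriv h w g)"
    if hw: "h \<in> {1..n}" "w \<in> Basis" for h w
  proof -
    have f: "has_partial_vderiv h w f (partial_deriv h w f z) z" if "z \<in> X" for z
      using Suc.prems(2) hw that by (auto simp: has_partial_deriv_works)
    have g: "has_partial_vderiv h w g (partial_deriv h w f z) z" if z: "z \<in> X" for z
      by (rule has_partial_vderiv_cong[OF X z hw(1) Suc.prems(1) f[OF z]])
    have "Ck_on n k X (partial_deriv h w g)"
    proof (rule Suc.IH)
      show "Ck_on n k X (partial_deriv h w f)"
        using Suc.prems(2) hw by simp
    qed (simp add: has_partial_vderiv_imp(2)[OF g])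
    with g show ?thesis
      using has_partial_vderiv_imp(1) by blast
  qed
  ultimately show ?case
    by simp
qed

text \<open>Any \<open>g\<close> that gives the derivative on \<open>X\<close> may replace
  \<open>partial_deriv\<close>, whose values off \<open>X\<close> are uncontrolled. The closure
  properties below are proved through this rule with explicit derivative formulas.\<close>

lemma Ck_on_SucI:
  assumes X: "openin (cspace n) X"
    and f: "continuous_map (subtopology (cspace n) X) euclidean f"
    and d: "\<And>h w. h \<in> {1..n} \<Longrightarrow> w \<in> Basis \<Longrightarrow>
      \<exists>g. (\<forall>z\<in>X. has_partial_vderiv h w f (g z) z) \<and> Ck_on n k X g"
  shows "Ck_on n (Suc k) X f"
proof -
  have "(\<forall>z\<in>X. has_partial_deriv h w f z) \<and> Ck_on n k X (partial_deriv h w f)"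
    if hw: "h \<in> {1..n}" "w \<in> Basis" for h w
  proof -
    obtain g where g: "\<And>z. z \<in> X \<Longrightarrow> has_partial_vderiv h w f (g z) z" "Ck_on n k X g"
      using d[OF hw] by blast
    have "Ck_on n k X (partial_deriv h w f)"
      by (rule Ck_on_cong[OF X _ g(2)]) (simp add: has_partial_vderiv_imp(2)[OF g(1)])
    with g show ?thesis
      using has_partial_vderiv_imp(1) by blast
  qed
  with f show ?thesis
    by simp
qed

lemma Ck_on_SucD:
  assumes "Ck_on n (Suc k) X f" "h \<in> {1..n}" "w \<in> Basis"
  shows "\<exists>g. (\<forall>z\<in>X. has_partial_vderiv h w f (g z) z) \<and> Ck_on n k X g"
  using assms by (intro exI[of _ "partial_deriv h w f"]) (auto simp: has_partial_deriv_works)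

lemma Ck_on_Suc_imp: "Ck_on n (Suc k) X f \<Longrightarrow> Ck_on n k X f"
  by (induction k arbitrary: f) auto

section \<open>Closure properties of \<open>C^k\<close> functions\<close>

lemma Ck_on_const:
  assumes X: "openin (cspace n) X"
  shows "Ck_on n k X (\<lambda>z. c)"
proof (induction k arbitrary: c)
  case (Suc k)
  then show ?case
    by (intro Ck_on_SucI[OF X]) (auto simp: has_partial_vderiv_def intro!: exI[of _ "\<lambda>z. 0"])
qed simp

lemma Ck_on_proj:
  assumes X: "openin (cspace n) X" and l: "l \<in> {1..n}"
  shows "Ck_on n k X (\<lambda>z. z l)"
proof (cases k)
  case 0
  then show ?thesis
    using l by (simp add: continuous_map_cspace_proj continuous_map_from_subtopology)
next
  case (Suc k)
  have "\<exists>g. (\<forall>z\<in>X. has_partial_vderiv h w (\<lambda>z. z l) (g z) z) \<and> Ck_on n k X g" for h w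
  proof (intro exI conjI ballI)
    fix z
    have "((\<lambda>t::real. z l + t *\<^sub>R w) has_vector_derivative w) (at 0)"
      by (auto intro!: derivative_eq_intros)
    then show "has_partial_vderiv h w (\<lambda>z. z l) (if l = h then w else 0) z"
      by (cases "l = h") (simp_all add: has_partial_vderiv_def)
  qed (rule Ck_on_const[OF X])
  then show ?thesis
    unfolding Suc
    using continuous_map_from_subtopology[OF continuous_map_cspace_proj[OF l]]
    by (rule Ck_on_SucI[OF X, rotated])
qed

lemma Ck_on_bounded_linear:
  assumes X: "openin (cspace n) X" and L: "bounded_linear L" and f: "Ck_on n k X f"
  shows "Ck_on n k X (\<lambda>z. L (f z))"
  using f
proof (induction k arbitrary: f)
  case 0
  then show ?case
    by (simp add: continuous_map_bounded_linear[OF L])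
next
  case (Suc k)
  show ?case
  proof (rule Ck_on_SucI[OF X])
    show "continuous_map (subtopology (cspace n) X) euclidean (\<lambda>z. L (f z))"
      by (rule continuous_map_bounded_linear[OF L Ck_on_imp_continuous[OF Suc.prems]])
    fix h and w :: 'a
    assume hw: "h \<in> {1..n}" "w \<in> Basis"
    obtain f' where f': "\<And>z. z \<in> X \<Longrightarrow> has_partial_vderiv h w f (f' z) z" "Ck_on n k X f'"
      using Ck_on_SucD[OF Suc.prems hw] by blast
    have "has_partial_vderiv h w (\<lambda>z. L (f z)) (L (f' z)) z" if "z \<in> X" for z
      using bounded_linear.has_vector_derivative[OF L f'(1)[OF that, unfolded has_partial_vderiv_def]]
      by (simp add: has_partial_vderiv_def)
    with Suc.IH[OF f'(2)] show "\<exists>g. (\<forall>z\<in>X. has_partial_vderiv h w (\<lambda>z. L (f z)) (g z) z) \<and> Ck_on n k X g"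
      by (intro exI[of _ "\<lambda>z. L (f' z)"]) blast
  qed
qed

lemma Ck_on_add:
  assumes X: "openin (cspace n) X" and "Ck_on n k X f" "Ck_on n k X g"
  shows "Ck_on n k X (\<lambda>z. f z + g z)"
  using assms(2,3)
proof (induction k arbitrary: f g)
  case 0
  then show ?case
    by (simp add: continuous_map_add)
next
  case (Suc k)
  show ?case
  proof (rule Ck_on_SucI[OF X])
    show "continuous_map (subtopology (cspace n) X) euclidean (\<lambda>z. f z + g z)"
      by (intro continuous_map_add Ck_on_imp_continuous[OF Suc.prems(1)] Ck_on_imp_continuous[OF Suc.prems(2)])
    fix h and w :: 'a
    assume hw: "h \<in> {1..n}" "w \<in> Basis"
    obtain f' where f': "\<And>z. z \<in> X \<Longrightarrow> has_partial_vderiv h w f (f' z) z" "Ck_on n k X f'"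
      using Ck_on_SucD[OF Suc.prems(1) hw] by blast
    obtain g' where g': "\<And>z. z \<in> X \<Longrightarrow> has_partial_vderiv h w g (g' z) z" "Ck_on n k X g'"
      using Ck_on_SucD[OF Suc.prems(2) hw] by blast
    have "has_partial_vderiv h w (\<lambda>z. f z + g z) (f' z + g' z) z" if "z \<in> X" for z
      using has_vector_derivative_add[OF f'(1)[OF that, unfolded has_partial_vderiv_def]
          g'(1)[OF that, unfolded has_partial_vderiv_def]]
      by (simp add: has_partial_vderiv_def)
    with Suc.IH[OF f'(2) g'(2)]
    show "\<exists>d. (\<forall>z\<in>X. has_partial_vderiv h w (\<lambda>z. f z + g z) (d z) z) \<and> Ck_on n k X d"
      by (intro exI[of _ "\<lambda>z. f' z + g' z"]) blast
  qed
qed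

text \<open>Leibniz rule with the order of the factors kept, as the algebra need not be
  commutative.\<close>

lemma Ck_on_mult:
  fixes f g :: "(nat \<Rightarrow> 'a::euclidean_space) \<Rightarrow> 'b::real_normed_algebra"
  assumes X: "openin (cspace n) X" and "Ck_on n k X f" "Ck_on n k X g"
  shows "Ck_on n k X (\<lambda>z. f z * g z)"
  using assms(2,3)
proof (induction k arbitrary: f g)
  case 0
  then show ?case
    by (simp add: continuous_map_mult)
next
  case (Suc k)
  show ?case
  proof (rule Ck_on_SucI[OF X])
    show "continuous_map (subtopology (cspace n) X) euclidean (\<lambda>z. f z * g z)"
      by (intro continuous_map_mult Ck_on_imp_continuous[OF Suc.prems(1)] Ck_on_imp_continuous[OF Suc.prems(2)])
    fix h and w :: 'a
    assume hw: "h \<in> {1..n}" "w \<in> Basis"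
    obtain f' where f': "\<And>z. z \<in> X \<Longrightarrow> has_partial_vderiv h w f (f' z) z" "Ck_on n k X f'"
      using Ck_on_SucD[OF Suc.prems(1) hw] by blast
    obtain g' where g': "\<And>z. z \<in> X \<Longrightarrow> has_partial_vderiv h w g (g' z) z" "Ck_on n k X g'"
      using Ck_on_SucD[OF Suc.prems(2) hw] by blast
    have "has_partial_vderiv h w (\<lambda>z. f z * g z) (f z * g' z + f' z * g z) z" if "z \<in> X" for z
      using has_vector_derivative_mult[OF f'(1)[OF that, unfolded has_partial_vderiv_def]
          g'(1)[OF that, unfolded has_partial_vderiv_def]]
      by (simp add: has_partial_vderiv_def)
    moreover have "Ck_on n k X (\<lambda>z. f z * g' z + f' z * g z)"
      by (intro Ck_on_add[OF X] Suc.IH f' g' Ck_on_Suc_imp[OF Suc.prems(1)] Ck_on_Suc_imp[OF Suc.prems(2)])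
    ultimately show "\<exists>d. (\<forall>z\<in>X. has_partial_vderiv h w (\<lambda>z. f z * g z) (d z) z) \<and> Ck_on n k X d"
      by (intro exI[of _ "\<lambda>z. f z * g' z + f' z * g z"]) blast
  qed
qed

text \<open>The derivative \<open>- (inverse f * f' * inverse f)\<close> involves only
  \<open>f'\<close> and the inverse of the same \<open>f\<close>, which is of class
  \<open>C^k\<close> by the induction hypothesis; so \<open>f\<close> stays fixed in the
  induction.\<close>

lemma Ck_on_inverse:
  fixes f :: "(nat \<Rightarrow> 'a::euclidean_space) \<Rightarrow> 'b::real_normed_div_algebra"
  assumes X: "openin (cspace n) X" and f: "Ck_on n k X f" and nz: "\<And>z. z \<in> X \<Longrightarrow> f z \<noteq> 0"
  shows "Ck_on n k X (\<lambda>z. inverse (f z))"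
proof -
  have c: "continuous_map (subtopology (cspace n) X) euclidean (\<lambda>z. inverse (f z))"
    by (rule continuous_map_inverse[OF Ck_on_imp_continuous[OF f]]) (simp add: nz)
  show ?thesis
    using f
  proof (induction k)
    case (Suc k)
    have inv: "Ck_on n k X (\<lambda>z. inverse (f z))"
      by (rule Suc.IH[OF Ck_on_Suc_imp[OF Suc.prems]])
    show ?case
    proof (rule Ck_on_SucI[OF X c])
      fix h and w :: 'a
      assume hw: "h \<in> {1..n}" "w \<in> Basis"
      obtain f' where f': "\<And>z. z \<in> X \<Longrightarrow> has_partial_vderiv h w f (f' z) z" "Ck_on n k X f'"
        using Ck_on_SucD[OF Suc.prems hw] by blast
      have "has_partial_vderiv h w (\<lambda>z. inverse (f z)) (- (inverse (f z) * f' z * inverse (f z))) z"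
        if "z \<in> X" for z
        using Deriv.has_derivative_inverse[OF _ f'(1)[OF that, unfolded has_partial_vderiv_def has_vector_derivative_def]] nz[OF that]
        by (simp add: has_partial_vderiv_def has_vector_derivative_def)
      moreover have "Ck_on n k X (\<lambda>z. - (inverse (f z) * f' z * inverse (f z)))"
        by (intro Ck_on_bounded_linear[OF X bounded_linear_minus[OF bounded_linear_ident]] Ck_on_mult[OF X] inv f')
      ultimately show "\<exists>d. (\<forall>z\<in>X. has_partial_vderiv h w (\<lambda>z. inverse (f z)) (d z) z) \<and> Ck_on n k X d"
        by (intro exI[of _ "\<lambda>z. - (inverse (f z) * f' z * inverse (f z))"]) blast
    qed
  qed (use c in simp)
qed

lemma Ck_on_prod:
  fixes f :: "'i \<Rightarrow> (nat \<Rightarrow> 'a::euclidean_space) \<Rightarrow> 'b::real_normed_field"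
  assumes X: "openin (cspace n) X" and "\<And>i. i \<in> I \<Longrightarrow> Ck_on n k X (f i)"
  shows "Ck_on n k X (\<lambda>z. \<Prod>i\<in>I. f i z)"
  using assms(2)
  by (induction I rule: infinite_finite_induct) (auto intro: Ck_on_mult[OF X] Ck_on_const[OF X])

section \<open>Ordered products of intrinsic functions\<close>

text \<open>Multiplying out selects one summand from each factor, and \<open>K\<close> collects the
  indices where the summand with \<open>J\<close> is taken. The real coefficients are central and
  gather on the right, while the units keep the order of the list.\<close>

lemma prod_list_of_real_add:
  fixes J :: "'i \<Rightarrow> 'a::real_algebra_1"
  assumes "distinct xs"
  shows "prod_list (map (\<lambda>h. of_real (c h False) + of_real (c h True) * J h) xs) =
    (\<Sum>K\<in>Pow (set xs). prod_list (map J (filter (\<lambda>h. h \<in> K) xs)) * of_real (\<Prod>h\<in>set xs. c h (h \<in> K)))"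
  using assms
proof (induction xs)
  case (Cons x xs)
  let ?t = "\<lambda>xs K. prod_list (map J (filter (\<lambda>h. h \<in> K) xs)) * of_real (\<Prod>h\<in>set xs. c h (h \<in> K))"
  have x: "x \<notin> set xs"
    using Cons.prems by simp
  have out: "?t (x # xs) K = of_real (c x False) * ?t xs K" if "K \<in> Pow (set xs)" for K
  proof -
    have "x \<notin> K"
      using that x by auto
    then show ?thesis
      using x by (simp add: of_real_def)
  qed
  have ins: "?t (x # xs) (insert x K) = of_real (c x True) * J x * ?t xs K" if "K \<in> Pow (set xs)" for K
  proof -
    have "filter (\<lambda>h. h = x \<or> h \<in> K) xs = filter (\<lambda>h. h \<in> K) xs"
      using x by (intro filter_cong) auto
    moreover have "(\<Prod>h\<in>set xs. c h (h = x \<or> h \<in> K)) = (\<Prod>h\<in>set xs. c h (h \<in> K))"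
    proof (rule prod.cong[OF refl])
      fix h
      assume "h \<in> set xs"
      then have "h \<noteq> x"
        using x by auto
      then show "c h (h = x \<or> h \<in> K) = c h (h \<in> K)"
        by simp
    qed
    ultimately show ?thesis
      using x by (simp add: of_real_def mult.assoc)
  qed
  \<comment> \<open>The subsets are split by whether they contain \<open>x\<close>; those that do
    are \<open>insert x K\<close> for a unique \<open>K\<close> among the subsets of
    \<open>set xs\<close>.\<close>
  have "(\<Sum>K\<in>Pow (set (x # xs)). ?t (x # xs) K) =
      (\<Sum>K\<in>Pow (set xs). ?t (x # xs) K) + (\<Sum>K\<in>insert x ` Pow (set xs). ?t (x # xs) K)"
    unfolding list.set Pow_insert using x by (intro sum.union_disjoint) auto
  also have "(\<Sum>K\<in>insert x ` Pow (set xs). ?t (x # xs) K) = (\<Sum>K\<in>Pow (set xs). ?t (x # xs) (insert x K))"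
    using x by (subst sum.reindex) (auto simp: inj_on_def o_def)
  also have "(\<Sum>K\<in>Pow (set xs). ?t (x # xs) K) + \<dots> =
      (\<Sum>K\<in>Pow (set xs). of_real (c x False) * ?t xs K) + (\<Sum>K\<in>Pow (set xs). of_real (c x True) * J x * ?t xs K)"
    by (intro arg_cong2[where f = "(+)"] sum.cong refl out ins)
  also have "\<dots> = (of_real (c x False) + of_real (c x True) * J x) * (\<Sum>K\<in>Pow (set xs). ?t xs K)"
    by (simp only: distrib_right sum_distrib_left[symmetric])
  also have "\<dots> = prod_list (map (\<lambda>h. of_real (c h False) + of_real (c h True) * J h) (x # xs))"
    using Cons.prems by (simp only: distinct.simps Cons.IH list.map prod_list.Cons)
  finally show ?case ..
qed simp

text \<open>Links the ordered product in the definition of slice regularity to the filtered lists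
  produced by the expansion.\<close>

lemma sorted_list_of_set_eq_filter:
  assumes "K \<subseteq> {1..n}"
  shows "sorted_list_of_set K = filter (\<lambda>h. h \<in> K) [1..<Suc n]"
proof -
  have "finite K"
    using assms finite_subset by blast
  then show ?thesis
    using assms by (intro sorted_distinct_set_unique) (auto simp: sorted_wrt_filter simp del: upt_Suc)
qed

section \<open>Stem functions of product form\<close>

text \<open>The Boolean index lets the membership \<open>h \<in> K\<close> select the real or the
  imaginary part.\<close>

definition re_im :: "bool \<Rightarrow> complex \<Rightarrow> real"
  where "re_im b w = (if b then Im w else Re w)"

lemma bounded_linear_re_im: "bounded_linear (re_im b)"
  by (cases b) (simp_all add: re_im_def [abs_def] bounded_linear_Re bounded_linear_Im)

text \<open>The \<open>K\<close>-component of the tensor product of the one-variable stem functions \<open>Re \<phi>\<^sub>h + \<i> Im \<phi>\<^sub>h\<close>.\<close>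

definition product_stem :: "nat \<Rightarrow> (nat \<Rightarrow> complex \<Rightarrow> complex) \<Rightarrow> nat set \<Rightarrow> (nat \<Rightarrow> complex) \<Rightarrow> quat"
  where "product_stem n \<phi> K z = of_real (\<Prod>h\<in>{1..n}. re_im (h \<in> K) (\<phi> h (z h)))"

text \<open>Separates the only factor that depends on the variable \<open>h\<close>, which reduces
  parity and derivatives to one variable.\<close>

lemma product_stem_upd:
  assumes "h \<in> {1..n}"
  shows "product_stem n \<phi> K (z(h := \<zeta>)) =
    of_real ((\<Prod>i\<in>{1..n} - {h}. re_im (i \<in> K) (\<phi> i (z i))) * re_im (h \<in> K) (\<phi> h \<zeta>))"
proof -
  have "(\<Prod>i\<in>{1..n} - {h}. re_im (i \<in> K) (\<phi> i ((z(h := \<zeta>)) i))) =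
      (\<Prod>i\<in>{1..n} - {h}. re_im (i \<in> K) (\<phi> i (z i)))"
    by (intro prod.cong) auto
  then show ?thesis
    unfolding product_stem_def by (subst prod.remove[OF _ assms]) (simp_all add: mult.commute)
qed

text \<open>Conjugating the variable \<open>h\<close> changes the sign of its factor exactly when
  that factor is an imaginary part. Passing from \<open>K\<close> to \<open>insert h K\<close>
  replaces Re by Im in this factor alone, so the required equations are the Cauchy-Riemann equations
  of \<open>\<phi> h\<close>, multiplied by a real number.\<close>

lemma holomorphic_product_stem:
  assumes D: "openin (cspace n) D"
    and \<phi>_C1: "\<And>h. h \<in> {1..n} \<Longrightarrow> Ck_on n 1 D (\<lambda>z. \<phi> h (z h))"
    and \<phi>_holo: "\<And>h z. h \<in> {1..n} \<Longrightarrow> z \<in> D \<Longrightarrow> \<phi> h field_differentiable at (z h)"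
    and \<phi>_cnj: "\<And>h w. h \<in> {1..n} \<Longrightarrow> \<phi> h (cnj w) = cnj (\<phi> h w)"
  shows "holomorphic_stem_function n D (product_stem n \<phi>)"
  unfolding holomorphic_stem_function_def C1_stem_function_def
proof (intro conjI allI impI ballI)
  fix K :: "nat set"
  assume "K \<subseteq> {1..n}"
  have "Ck_on n 1 D (\<lambda>z. of_real (\<Prod>h\<in>{1..n}. re_im (h \<in> K) (\<phi> h (z h))) :: quat)"
    by (rule Ck_on_bounded_linear[OF D bounded_linear_of_real Ck_on_prod[OF D
            Ck_on_bounded_linear[OF D bounded_linear_re_im \<phi>_C1]]])
  then show "Ck_on n 1 D (product_stem n \<phi> K)"
    by (simp only: product_stem_def [abs_def])
next
  fix K :: "nat set" and h z
  assume h: "h \<in> {1..n}"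
  have "product_stem n \<phi> K (z(h := cnj (z h))) = (if h \<in> K then - 1 else 1) * product_stem n \<phi> K (z(h := z h))"
    unfolding product_stem_upd[OF h] \<phi>_cnj[OF h] by (simp add: re_im_def)
  then show "product_stem n \<phi> K (z(h := cnj (z h))) = (if h \<in> K then - product_stem n \<phi> K z else product_stem n \<phi> K z)"
    by simp
next
  fix h K z
  assume h: "h \<in> {1..n}" and K: "K \<subseteq> {1..n} \<and> h \<notin> K" and z: "z \<in> D"
  obtain d where d: "(\<phi> h has_field_derivative d) (at (z h))"
    using \<phi>_holo[OF h z] unfolding field_differentiable_def by blast
  define r where "r = (\<Prod>i\<in>{1..n} - {h}. re_im (i \<in> K) (\<phi> i (z i)))"
  have r: "r = (\<Prod>i\<in>{1..n} - {h}. re_im (i \<in> insert h K) (\<phi> i (z i)))"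
    unfolding r_def by (intro prod.cong) auto
  \<comment> \<open>Complex differentiability makes the derivative in direction \<open>w\<close>
    equal to \<open>w * d\<close>. For \<open>w = 1\<close> and \<open>w = \<i>\<close> the
    Cauchy-Riemann equations become \<open>Re d = Im (\<i> * d)\<close> and
    \<open>Re (\<i> * d) = - Im d\<close>.\<close>
  have line: "((\<lambda>t. \<phi> h (z h + t *\<^sub>R w)) has_vector_derivative (w * d)) (at 0)" for w
  proof -
    have "((\<lambda>t::real. z h + t *\<^sub>R w) has_vector_derivative w) (at 0)"
      by (auto intro!: derivative_eq_intros)
    from field_vector_diff_chain_at[OF this, of "\<phi> h" d] d show ?thesis
      by (simp add: o_def)
  qed
  have pd: "has_partial_vderiv h w (product_stem n \<phi> L) (of_real (r * re_im (h \<in> L) (w * d))) z"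
    if "L = K \<or> L = insert h K" for w L
  proof -
    have rL: "(\<Prod>i\<in>{1..n} - {h}. re_im (i \<in> L) (\<phi> i (z i))) = r"
      using that r r_def by auto
    have "((\<lambda>t. re_im (h \<in> L) (\<phi> h (z h + t *\<^sub>R w))) has_vector_derivative re_im (h \<in> L) (w * d)) (at 0)"
      by (rule bounded_linear.has_vector_derivative[OF bounded_linear_re_im line])
    from bounded_linear.has_vector_derivative[OF bounded_linear_of_real
        bounded_linear.has_vector_derivative[OF bounded_linear_mult_right[of r] this]]
    show ?thesis
      unfolding has_partial_vderiv_def product_stem_upd[OF h] rL .
  qed
  have "h \<notin> K"
    using K by simp
  then show "partial_deriv h 1 (product_stem n \<phi> K) z = partial_deriv h \<i> (product_stem n \<phi> (insert h K)) z"
    "partial_deriv h \<i> (product_stem n \<phi> K) z = - partial_deriv h 1 (product_stem n \<phi> (insert h K)) z"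
    by (simp_all add: has_partial_vderiv_imp(2)[OF pd] re_im_def)
qed

text \<open>On the slices chosen by \<open>J\<close> each factor is a real number plus a real
  multiple of \<open>J h\<close>. The expanded product thus has the shape of the defining sum, with
  \<open>product_stem\<close> as stem function.\<close>

lemma product_slice_regular:
  assumes D: "openin (cspace n) D"
    and \<phi>_C1: "\<And>h. h \<in> {1..n} \<Longrightarrow> Ck_on n 1 D (\<lambda>z. \<phi> h (z h))"
    and \<phi>_holo: "\<And>h z. h \<in> {1..n} \<Longrightarrow> z \<in> D \<Longrightarrow> \<phi> h field_differentiable at (z h)"
    and \<phi>_cnj: "\<And>h w. h \<in> {1..n} \<Longrightarrow> \<phi> h (cnj w) = cnj (\<phi> h w)"
    and \<Phi>: "\<And>h x y J. h \<in> {1..n} \<Longrightarrow> J \<in> imaginary_units \<Longrightarrow>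
      \<Phi> h (of_real x + of_real y * J) = of_real (Re (\<phi> h (Complex x y))) + of_real (Im (\<phi> h (Complex x y))) * J"
  shows "left_slice_regular n D (\<lambda>q. prod_list (map (\<lambda>h. \<Phi> h (q h)) [1..<Suc n]))"
    and "right_slice_regular n D (\<lambda>q. prod_list (map (\<lambda>h. \<Phi> h (q h)) (rev [1..<Suc n])))"
proof -
  have holo: "holomorphic_stem_function n D (product_stem n \<phi>)"
    using assms(1-4) by (rule holomorphic_product_stem)
  \<comment> \<open>An arbitrary enumeration \<open>xs\<close> of the variables covers both the
    increasing and the decreasing order.\<close>
  have expand: "prod_list (map (\<lambda>h. \<Phi> h (qpoint n x y J h)) xs) =
      (\<Sum>K\<in>Pow {1..n}. prod_list (map J (filter (\<lambda>h. h \<in> K) xs)) * product_stem n \<phi> K (cpoint n x y))"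
    if J: "\<forall>h\<in>{1..n}. J h \<in> imaginary_units" and xs: "distinct xs" "set xs = {1..n}" for x y J xs
  proof -
    let ?c = "\<lambda>h b. re_im b (\<phi> h (Complex (x h) (y h)))"
    have "map (\<lambda>h. \<Phi> h (qpoint n x y J h)) xs =
        map (\<lambda>h. of_real (?c h False) + of_real (?c h True) * J h) xs"
      using J xs by (simp add: qpoint_def re_im_def \<Phi>)
    then have "prod_list (map (\<lambda>h. \<Phi> h (qpoint n x y J h)) xs) =
        (\<Sum>K\<in>Pow {1..n}. prod_list (map J (filter (\<lambda>h. h \<in> K) xs)) * of_real (\<Prod>h\<in>{1..n}. ?c h (h \<in> K)))"
      by (simp only: prod_list_of_real_add[OF xs(1), of ?c] xs(2))
    then show ?thesis
      by (simp add: product_stem_def cpoint_def)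
  qed
  show "left_slice_regular n D (\<lambda>q. prod_list (map (\<lambda>h. \<Phi> h (q h)) [1..<Suc n]))"
    unfolding left_slice_regular_def
  proof (intro exI conjI allI impI, rule holo)
    fix x y J
    assume "(\<forall>h\<in>{1..n}. J h \<in> imaginary_units) \<and> cpoint n x y \<in> D"
    then have "prod_list (map (\<lambda>h. \<Phi> h (qpoint n x y J h)) [1..<Suc n]) =
      (\<Sum>K\<in>Pow {1..n}. prod_list (map J (filter (\<lambda>h. h \<in> K) [1..<Suc n])) * product_stem n \<phi> K (cpoint n x y))"
      by (intro expand) auto
    also have "\<dots> = (\<Sum>K\<in>Pow {1..n}. prod_list (map J (sorted_list_of_set K)) * product_stem n \<phi> K (cpoint n x y))"
      by (intro sum.cong refl) (simp only: sorted_list_of_set_eq_filter Pow_iff)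
    finally show "prod_list (map (\<lambda>h. \<Phi> h (qpoint n x y J h)) [1..<Suc n]) = \<dots>" .
  qed
  show "right_slice_regular n D (\<lambda>q. prod_list (map (\<lambda>h. \<Phi> h (q h)) (rev [1..<Suc n])))"
    unfolding right_slice_regular_def
  proof (intro exI conjI allI impI, rule holo)
    fix x y J
    assume "(\<forall>h\<in>{1..n}. J h \<in> imaginary_units) \<and> cpoint n x y \<in> D"
    then have "prod_list (map (\<lambda>h. \<Phi> h (qpoint n x y J h)) (rev [1..<Suc n])) =
      (\<Sum>K\<in>Pow {1..n}. prod_list (map J (filter (\<lambda>h. h \<in> K) (rev [1..<Suc n]))) * product_stem n \<phi> K (cpoint n x y))"
      by (intro expand) auto
    \<comment> \<open>The expansion has the stem component on the right; as a real multiple of 1 it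
      is central and moves to the left.\<close>
    also have "\<dots> = (\<Sum>K\<in>Pow {1..n}. product_stem n \<phi> K (cpoint n x y) * prod_list (map J (rev (sorted_list_of_set K))))"
      by (intro sum.cong refl)
        (simp only: sorted_list_of_set_eq_filter Pow_iff rev_filter product_stem_def of_real_def
          mult_scaleR_left mult_scaleR_right mult_1_left mult_1_right)
    finally show "prod_list (map (\<lambda>h. \<Phi> h (qpoint n x y J h)) (rev [1..<Suc n])) = \<dots>" .
  qed
qed

section \<open>The topology of quaternionic projective space\<close>

text \<open>Restriction to \<open>{1..n}\<close> is a retraction from the second countable space of
  all functions on the natural numbers.\<close>

lemma second_countable_cspace:
  "second_countable (cspace n :: (nat \<Rightarrow> 'a::second_countable_topology) topology)"
proof (rule second_countable_retraction_map_image)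
  show "second_countable (euclidean :: (nat \<Rightarrow> 'a) topology)"
  proof -
    obtain \<B> :: "(nat \<Rightarrow> 'a) set set" where "countable \<B>" "\<And>C. C \<in> \<B> \<Longrightarrow> open C"
      "\<And>S. open S \<Longrightarrow> \<exists>U. U \<subseteq> \<B> \<and> S = \<Union>U"
      using univ_second_countable by blast
    then show ?thesis
      unfolding second_countable_def by (intro exI[of _ \<B>]) (fastforce simp: open_openin[symmetric])
  qed
  have restr: "continuous_map euclidean (cspace n) (\<lambda>z :: nat \<Rightarrow> 'a. restrict z {1..n})"
    unfolding continuous_map_into_cspace
    using continuous_map_product_projection[of _ UNIV "\<lambda>_. euclidean :: 'a topology"]
    by (auto simp: euclidean_product_topology)
  have incl: "continuous_map (cspace n) euclidean (\<lambda>z :: nat \<Rightarrow> 'a. z)"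
    unfolding euclidean_product_topology[symmetric] continuous_map_componentwise_UNIV
  proof
    fix h
    show "continuous_map (cspace n) euclidean (\<lambda>z :: nat \<Rightarrow> 'a. z h)"
    proof (cases "h \<in> {1..n}")
      \<comment> \<open>Outside the index range the coordinate of an extensional function is the
        constant \<open>undefined\<close>.\<close>
      case False
      then have "continuous_map (cspace n) euclidean (\<lambda>z :: nat \<Rightarrow> 'a. undefined :: 'a)"
        by simp
      then show ?thesis
        by (rule continuous_map_eq) (use False in \<open>auto simp: topspace_cspace PiE_def extensional_def\<close>)
    qed (rule continuous_map_cspace_proj)
  qed
  show "retraction_map euclidean (cspace n) (\<lambda>z :: nat \<Rightarrow> 'a. restrict z {1..n})"
    unfolding retraction_map_def retraction_maps_def
    by (intro exI[of _ "\<lambda>z. z"] conjI restr incl) (auto simp: topspace_cspace PiE_def extensional_restrict)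
qed

lemma Hausdorff_space_cspace: "Hausdorff_space (cspace n :: (nat \<Rightarrow> 'a::metric_space) topology)"
  unfolding cspace_def Hausdorff_space_product_topology by (simp add: Hausdorff_space_euclidean)

section \<open>Right lines and their quotient map\<close>

lemma punctured_space_scale:
  assumes "a \<in> punctured_space n" "c \<noteq> 0"
  shows "(\<lambda>h\<in>{1..n + 1}. a h * c) \<in> punctured_space n"
  using assms by (auto simp: punctured_space_def)

lemma scale_in_right_line: "(\<lambda>h\<in>{1..n + 1}. a h * c) \<in> right_line n a"
  unfolding right_line_def by blast

lemma self_in_right_line:
  assumes "a \<in> punctured_space n"
  shows "a \<in> right_line n a"
proof -
  have "a = (\<lambda>h\<in>{1..n + 1}. a h * 1)"
    using assms by (auto simp: punctured_space_def PiE_def extensional_def)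
  then show ?thesis
    using scale_in_right_line[where a = a and c = 1 and n = n] by (simp only:)
qed

lemma right_line_scale:
  assumes "c \<noteq> 0"
  shows "right_line n (\<lambda>h\<in>{1..n + 1}. a h * c) = right_line n a"
proof (intro equalityI subsetI)
  fix b
  assume "b \<in> right_line n (\<lambda>h\<in>{1..n + 1}. a h * c)"
  then obtain d where "b = (\<lambda>h\<in>{1..n + 1}. a h * (c * d))"
    unfolding right_line_def by (auto simp: mult.assoc cong: restrict_cong)
  then show "b \<in> right_line n a"
    by (simp only: scale_in_right_line)
next
  fix b
  assume "b \<in> right_line n a"
  then obtain d where d: "b = (\<lambda>h\<in>{1..n + 1}. a h * d)"
    unfolding right_line_def by blast
  have "a h * d = a h * c * (inverse c * d)" for h
    using assms by (simp add: mult.assoc flip: mult.assoc[of c])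
  then have "b = (\<lambda>h\<in>{1..n + 1}. (\<lambda>h\<in>{1..n + 1}. a h * c) h * (inverse c * d))"
    unfolding d by (intro restrict_ext) simp
  then show "b \<in> right_line n (\<lambda>h\<in>{1..n + 1}. a h * c)"
    by (simp only: scale_in_right_line)
qed

lemma right_line_eqD:
  assumes "a \<in> punctured_space n" "b \<in> punctured_space n" "right_line n a = right_line n b"
  obtains c where "c \<noteq> 0" "b = (\<lambda>h\<in>{1..n + 1}. a h * c)"
proof -
  have "b \<in> right_line n a"
    using self_in_right_line[OF assms(2)] assms(3) by simp
  then obtain c where c: "b = (\<lambda>h\<in>{1..n + 1}. a h * c)"
    unfolding right_line_def by blast
  moreover have "c \<noteq> 0"
    using assms(2) c by (auto simp: punctured_space_def)
  ultimately show thesis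
    using that by blast
qed

lemma continuous_map_punctured_proj:
  "h \<in> {1..n + 1} \<Longrightarrow> continuous_map (subtopology (cspace (n + 1)) (punctured_space n)) euclidean (\<lambda>a. a h)"
  by (intro continuous_map_from_subtopology continuous_map_cspace_proj)

text \<open>The preimage of the image of \<open>U\<close> is the union over all nonzero
  \<open>c\<close> of the preimages of \<open>U\<close> under right scaling by \<open>c\<close>, and
  each scaling is continuous.\<close>

lemma open_map_right_line:
  "open_map (subtopology (cspace (n + 1)) (punctured_space n)) (HP_space n) (right_line n)"
  unfolding open_map_def
proof (intro allI impI)
  let ?P = "subtopology (cspace (n + 1)) (punctured_space n)"
  fix U
  assume U: "openin ?P U"
  then have sub: "U \<subseteq> punctured_space n"
    using openin_subset topspace_punctured by metis
  have "openin ?P {a \<in> punctured_space n. (\<lambda>h\<in>{1..n + 1}. a h * c) \<in> U}" if "c \<noteq> 0" for c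
  proof -
    have "continuous_map ?P ?P (\<lambda>a. \<lambda>h\<in>{1..n + 1}. a h * c)"
      unfolding continuous_map_in_subtopology continuous_map_into_cspace
    proof (intro conjI ballI)
      fix h
      assume h: "h \<in> {1..n + 1}"
      have "continuous_map ?P euclidean (\<lambda>a. a h * c)"
        by (intro continuous_map_mult continuous_map_punctured_proj[OF h]) simp
      then show "continuous_map ?P euclidean (\<lambda>a. (\<lambda>h\<in>{1..n + 1}. a h * c) h)"
        using h by simp
    next
      show "(\<lambda>a. \<lambda>h\<in>{1..n + 1}. a h * c) ` topspace ?P \<subseteq> extensional {1..n + 1}"
        by auto
      show "(\<lambda>a. \<lambda>h\<in>{1..n + 1}. a h * c) \<in> topspace ?P \<rightarrow> punctured_space n"
        unfolding topspace_punctured by (rule Pi_I) (rule punctured_space_scale[OF _ that])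
    qed
    from openin_continuous_map_preimage[OF this U] show ?thesis
      unfolding topspace_punctured .
  qed
  then have "openin ?P (\<Union>c\<in>-{0}. {a \<in> punctured_space n. (\<lambda>h\<in>{1..n + 1}. a h * c) \<in> U})"
    by (intro openin_Union) auto
  also have "(\<Union>c\<in>-{0}. {a \<in> punctured_space n. (\<lambda>h\<in>{1..n + 1}. a h * c) \<in> U}) =
      {a \<in> punctured_space n. right_line n a \<in> right_line n ` U}"
  proof (intro equalityI subsetI)
    fix a
    assume "a \<in> {a \<in> punctured_space n. right_line n a \<in> right_line n ` U}"
    then obtain b where ab: "a \<in> punctured_space n" "b \<in> U" "right_line n a = right_line n b"
      by blast
    then obtain c where "c \<noteq> 0" "b = (\<lambda>h\<in>{1..n + 1}. a h * c)"
      using right_line_eqD[of a n b] sub by blast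
    with ab show "a \<in> (\<Union>c\<in>-{0}. {a \<in> punctured_space n. (\<lambda>h\<in>{1..n + 1}. a h * c) \<in> U})"
      by blast
  next
    fix a
    assume "a \<in> (\<Union>c\<in>-{0}. {a \<in> punctured_space n. (\<lambda>h\<in>{1..n + 1}. a h * c) \<in> U})"
    then obtain c where "a \<in> punctured_space n" "c \<noteq> 0" "(\<lambda>h\<in>{1..n + 1}. a h * c) \<in> U"
      by blast
    with right_line_scale[of c n a] show "a \<in> {a \<in> punctured_space n. right_line n a \<in> right_line n ` U}"
      by (metis (mono_tags, lifting) imageI mem_Collect_eq)
  qed
  finally show "openin (HP_space n) (right_line n ` U)"
    unfolding openin_HP_space using sub by (auto simp: HP_def)
qed

text \<open>Second countability passes to the image of an open continuous map; being a quotient map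
  alone would not suffice.\<close>

lemma second_countable_HP_space: "second_countable (HP_space n)"
  using quotient_imp_continuous_map[OF quotient_map_HP] open_map_right_line
    quotient_imp_surjective_map[OF quotient_map_HP] second_countable_subtopology[OF second_countable_cspace]
  by (rule second_countable_open_map_image)

section \<open>Domains of the natural charts\<close>

lemma natural_domain_eq: "natural_domain n i = right_line n ` {a \<in> punctured_space n. a i \<noteq> 0}"
  unfolding natural_domain_def by blast

lemma right_line_in_natural_domain_iff:
  assumes a: "a \<in> punctured_space n"
  shows "right_line n a \<in> natural_domain n i \<longleftrightarrow> a i \<noteq> 0"
proof
  assume "right_line n a \<in> natural_domain n i"
  then obtain b where b: "b \<in> punctured_space n" "b i \<noteq> 0" "right_line n a = right_line n b"
    unfolding natural_domain_def by blast
  then obtain c where "b = (\<lambda>h\<in>{1..n + 1}. a h * c)"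
    using right_line_eqD[OF a b(1)] by blast
  \<comment> \<open>For \<open>i\<close> outside the index range both coordinates equal
    \<open>undefined\<close>, so nonvanishing transfers from \<open>b\<close> to \<open>a\<close> in
    this case as well.\<close>
  moreover have "a i = undefined" "b i = undefined" if "i \<notin> {1..n + 1}"
    using a b(1) that by (auto simp: punctured_space_def PiE_def extensional_def)
  ultimately show "a i \<noteq> 0"
    using b(2) by (cases "i \<in> {1..n + 1}") auto
qed (use a in \<open>auto simp: natural_domain_def\<close>)

lemma openin_punctured_nonzero:
  assumes "i \<in> {1..n + 1}"
  shows "openin (subtopology (cspace (n + 1)) (punctured_space n)) {a \<in> punctured_space n. a i \<noteq> 0}"
  using openin_continuous_map_preimage[OF continuous_map_punctured_proj[OF assms], of "- {0}"]
  unfolding topspace_punctured by (simp add: open_Compl)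

lemma openin_natural_domain:
  assumes "i \<in> {1..n + 1}"
  shows "openin (HP_space n) (natural_domain n i)"
  using open_map_right_line openin_punctured_nonzero[OF assms]
  unfolding natural_domain_eq open_map_def by blast

lemma Union_natural_domain: "(\<Union>i\<in>{1..n + 1}. natural_domain n i) = HP n"
  unfolding natural_domain_def HP_def punctured_space_def by auto

section \<open>Affine coordinates and the inverse of a chart\<close>

text \<open>Position of the homogeneous coordinate \<open>h\<close> among the affine coordinates of the \<open>i\<close>-th chart;
  index \<open>0\<close> stands for the coordinate normalised to \<open>1\<close>.\<close>

definition affine_index :: "nat \<Rightarrow> nat \<Rightarrow> nat"
  where "affine_index i h = (if h < i then h else if h = i then 0 else h - 1)"

definition affine_coord :: "(nat \<Rightarrow> quat) \<Rightarrow> nat \<Rightarrow> quat"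
  where "affine_coord q l = (if l = 0 then 1 else q l)"

text \<open>The representative with 1 inserted at position \<open>i\<close>; followed by
  \<open>right_line\<close> it inverts the natural chart.\<close>

definition affine_lift :: "nat \<Rightarrow> nat \<Rightarrow> (nat \<Rightarrow> quat) \<Rightarrow> (nat \<Rightarrow> quat)"
  where "affine_lift n i q = (\<lambda>h\<in>{1..n + 1}. affine_coord q (affine_index i h))"

lemma affine_index_le: "i \<in> {1..n + 1} \<Longrightarrow> h \<in> {1..n + 1} \<Longrightarrow> affine_index i h \<le> n"
  by (auto simp: affine_index_def)

text \<open>Positive indices below \<open>i\<close> are kept, those above land at \<open>i\<close>
  or higher, and only \<open>i\<close> itself goes to 0. This keeps numerator and denominator of a
  transition component distinct.\<close>

lemma affine_index_inj:
  "\<lbrakk>i \<ge> 1; h \<ge> 1; k \<ge> 1; affine_index i h = affine_index i k\<rbrakk> \<Longrightarrow> h = k"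
  by (auto simp: affine_index_def split: if_splits)

lemma affine_lift_self: "i \<in> {1..n + 1} \<Longrightarrow> affine_lift n i q i = 1"
  by (simp add: affine_lift_def affine_index_def affine_coord_def)

lemma affine_lift_punctured: "i \<in> {1..n + 1} \<Longrightarrow> affine_lift n i q \<in> punctured_space n"
  using affine_lift_self[of i n q] by (auto simp: punctured_space_def affine_lift_def intro!: bexI[of _ i])

lemma natural_coords_affine_lift:
  assumes i: "i \<in> {1..n + 1}" and q: "q \<in> {1..n} \<rightarrow>\<^sub>E UNIV"
  shows "natural_coords n i (right_line n (affine_lift n i q)) = q"
proof -
  have "natural_coords n i (right_line n (affine_lift n i q)) =
      (\<lambda>k\<in>{1..n}. affine_lift n i q (if k < i then k else k + 1))"
    using affine_lift_self[OF i, of q]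
    by (subst natural_coords_right_line[OF affine_lift_punctured[OF i] i]) simp_all
  also have "\<dots> = (\<lambda>k\<in>{1..n}. q k)"
    by (intro restrict_ext) (auto simp: affine_lift_def affine_index_def affine_coord_def)
  also have "\<dots> = q"
    using q by (simp add: PiE_def extensional_restrict)
  finally show ?thesis .
qed

text \<open>The lift of the coordinates of the line of \<open>a\<close> is \<open>a\<close> scaled
  on the right by \<open>inverse (a i)\<close>, which spans the same line.\<close>

lemma affine_lift_natural_coords:
  assumes i: "i \<in> {1..n + 1}" and L: "L \<in> natural_domain n i"
  shows "right_line n (affine_lift n i (natural_coords n i L)) = L"
proof -
  obtain a where a: "a \<in> punctured_space n" "a i \<noteq> 0" "L = right_line n a"
    using L unfolding natural_domain_def by blast
  have "affine_lift n i (natural_coords n i L) = (\<lambda>h\<in>{1..n + 1}. a h * inverse (a i))"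
    unfolding affine_lift_def a(3) natural_coords_right_line[OF a(1) i a(2)]
  proof (rule restrict_ext)
    fix h
    assume h: "h \<in> {1..n + 1}"
    consider "h < i" | "h = i" | "h > i"
      by linarith
    then show "affine_coord (\<lambda>k\<in>{1..n}. a (if k < i then k else k + 1) * inverse (a i)) (affine_index i h) =
        a h * inverse (a i)"
      by cases (use h i a(2) in \<open>auto simp: affine_coord_def affine_index_def\<close>)
  qed
  then show ?thesis
    using a right_line_scale[of "inverse (a i)" n a] by simp
qed

lemma natural_coords_in: "natural_coords n i L \<in> {1..n} \<rightarrow>\<^sub>E UNIV"
  by (simp add: natural_coords_def Let_def)

lemma affine_lift_in_domain: "i \<in> {1..n + 1} \<Longrightarrow> right_line n (affine_lift n i q) \<in> natural_domain n i"
  by (simp only: right_line_in_natural_domain_iff[OF affine_lift_punctured]) (simp add: affine_lift_self)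

lemma natural_coords_image:
  assumes "i \<in> {1..n + 1}"
  shows "natural_coords n i ` natural_domain n i = {1..n} \<rightarrow>\<^sub>E UNIV"
proof (intro equalityI subsetI)
  fix q :: "nat \<Rightarrow> quat"
  assume "q \<in> {1..n} \<rightarrow>\<^sub>E UNIV"
  then show "q \<in> natural_coords n i ` natural_domain n i"
    using natural_coords_affine_lift[OF assms] affine_lift_in_domain[OF assms] by (metis image_eqI)
qed (use natural_coords_in in blast)

section \<open>Natural charts as homeomorphisms\<close>

text \<open>\<open>right_line\<close> remains a quotient map over the open set
  \<open>natural_domain n i\<close>, so continuity is checked on representatives, where the
  coordinates are explicit ratios.\<close>

lemma continuous_map_natural_coords:
  assumes i: "i \<in> {1..n + 1}"
  shows "continuous_map (subtopology (HP_space n) (natural_domain n i)) (cspace n) (natural_coords n i)"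
proof -
  let ?P = "subtopology (cspace (n + 1)) (punctured_space n)"
  let ?V = "{a \<in> punctured_space n. a i \<noteq> 0}"
  have "quotient_map (subtopology ?P ?V) (subtopology (HP_space n) (natural_domain n i)) (right_line n)"
  proof (rule quotient_map_restriction[OF quotient_map_HP])
    show "{a \<in> topspace ?P. right_line n a \<in> natural_domain n i} = ?V"
      unfolding topspace_punctured using right_line_in_natural_domain_iff by blast
  qed (simp add: openin_natural_domain[OF i])
  moreover have "continuous_map (subtopology ?P ?V) (cspace n) (natural_coords n i \<circ> right_line n)"
  proof (rule continuous_map_eq)
    have top: "topspace (subtopology ?P ?V) = ?V"
      by (simp add: topspace_cspace) (auto simp: punctured_space_def)
    show "continuous_map (subtopology ?P ?V) (cspace n)
        (\<lambda>a. \<lambda>k\<in>{1..n}. a (if k < i then k else k + 1) * inverse (a i))"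
      unfolding continuous_map_into_cspace
    proof (intro conjI ballI)
      fix k
      assume k: "k \<in> {1..n}"
      have "continuous_map (subtopology ?P ?V) euclidean (\<lambda>a. a (if k < i then k else k + 1) * inverse (a i))"
        by (intro continuous_map_mult continuous_map_inverse
            continuous_map_from_subtopology[OF continuous_map_punctured_proj]) (use k i top in auto)
      then show "continuous_map (subtopology ?P ?V) euclidean
          (\<lambda>a. (\<lambda>k\<in>{1..n}. a (if k < i then k else k + 1) * inverse (a i)) k)"
        using k by simp
    qed auto
    fix a
    assume "a \<in> topspace (subtopology ?P ?V)"
    then show "(\<lambda>k\<in>{1..n}. a (if k < i then k else k + 1) * inverse (a i)) = (natural_coords n i \<circ> right_line n) a"
      unfolding top by (simp add: natural_coords_right_line[OF _ i])
  qed
  ultimately show ?thesis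
    by (rule continuous_compose_quotient_map)
qed

lemma continuous_map_affine_lift:
  assumes i: "i \<in> {1..n + 1}"
  shows "continuous_map (cspace n) (subtopology (HP_space n) (natural_domain n i)) (\<lambda>q. right_line n (affine_lift n i q))"
proof -
  have "continuous_map (cspace n) (subtopology (cspace (n + 1)) (punctured_space n)) (affine_lift n i)"
    unfolding continuous_map_in_subtopology continuous_map_into_cspace
  proof (intro conjI ballI)
    fix h
    assume h: "h \<in> {1..n + 1}"
    have "continuous_map (cspace n) euclidean (\<lambda>q. affine_coord q (affine_index i h))"
      using affine_index_le[OF i h] continuous_map_cspace_proj[of "affine_index i h" n]
      by (cases "affine_index i h = 0") (auto simp: affine_coord_def)
    then show "continuous_map (cspace n) euclidean (\<lambda>q. affine_lift n i q h)"
      using h by (simp add: affine_lift_def)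
  qed (auto simp: affine_lift_punctured[OF i], simp add: affine_lift_def)
  from continuous_map_compose[OF this quotient_imp_continuous_map[OF quotient_map_HP]]
  show ?thesis
    unfolding continuous_map_in_subtopology using affine_lift_in_domain[OF i] by (auto simp: o_def)
qed

lemma homeomorphic_map_natural_coords:
  assumes i: "i \<in> {1..n + 1}"
  shows "homeomorphic_map (subtopology (HP_space n) (natural_domain n i)) (cspace n) (natural_coords n i)"
  unfolding homeomorphic_map_maps homeomorphic_maps_def
  using continuous_map_natural_coords[OF i] continuous_map_affine_lift[OF i]
    affine_lift_natural_coords[OF i] natural_coords_affine_lift[OF i]
  by (intro exI[of _ "\<lambda>q. right_line n (affine_lift n i q)"]) (auto simp: topspace_cspace)

text \<open>The chart maps onto the whole coordinate space, so its image is open and carries the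
  full topology.\<close>

lemma chart_on_natural_chart:
  assumes i: "i \<in> {1..n + 1}"
  shows "chart_on n (HP_space n) (natural_chart n i)"
proof -
  have "openin (cspace n) ({1..n} \<rightarrow>\<^sub>E (UNIV :: quat set))"
    using openin_topspace[of "cspace n"] unfolding topspace_cspace .
  moreover have "subtopology (cspace n) ({1..n} \<rightarrow>\<^sub>E (UNIV :: quat set)) = cspace n"
    using subtopology_topspace[of "cspace n"] unfolding topspace_cspace .
  ultimately show ?thesis
    unfolding chart_on_def natural_chart_def prod.case natural_coords_image[OF i]
    using homeomorphic_map_natural_coords[OF i] openin_natural_domain[OF i] by simp
qed

section \<open>Separation of lines\<close>

text \<open>Two lines in a common chart domain are separated inside it, since it is homeomorphic to
  a Hausdorff space. Otherwise no coordinate is nonzero on both, and comparing the norms of two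
  coordinates separates them.\<close>

lemma Hausdorff_space_HP_space: "Hausdorff_space (HP_space n)"
  unfolding Hausdorff_space_def
proof (intro allI impI, elim conjE)
  let ?P = "subtopology (cspace (n + 1)) (punctured_space n)"
  fix L M
  assume "L \<in> topspace (HP_space n)" "M \<in> topspace (HP_space n)" and LM: "L \<noteq> M"
  then obtain a b where a: "a \<in> punctured_space n" "L = right_line n a"
    and b: "b \<in> punctured_space n" "M = right_line n b"
    unfolding topspace_HP_space HP_def by blast
  show "\<exists>U V. openin (HP_space n) U \<and> openin (HP_space n) V \<and> L \<in> U \<and> M \<in> V \<and> disjnt U V"
  proof (cases "\<exists>i\<in>{1..n + 1}. a i \<noteq> 0 \<and> b i \<noteq> 0")
    case True
    then obtain i where i: "i \<in> {1..n + 1}" and ab: "a i \<noteq> 0" "b i \<noteq> 0"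
      by blast
    let ?S = "subtopology (HP_space n) (natural_domain n i)"
    have "Hausdorff_space ?S"
      using homeomorphic_map_imp_homeomorphic_space[OF homeomorphic_map_natural_coords[OF i]]
        Hausdorff_space_cspace homeomorphic_Hausdorff_space by blast
    moreover have "L \<in> topspace ?S" "M \<in> topspace ?S"
      using a b ab right_line_in_natural_domain_iff by (auto simp: topspace_HP_space HP_def)
    ultimately obtain U V where "openin ?S U" "openin ?S V" "L \<in> U" "M \<in> V" "disjnt U V"
      unfolding Hausdorff_space_def using LM by meson
    then show ?thesis
      using openin_trans_full[OF _ openin_natural_domain[OF i]] by blast
  next
    case False
    obtain i k where i: "i \<in> {1..n + 1}" "a i \<noteq> 0" and k: "k \<in> {1..n + 1}" "b k \<noteq> 0"
      using a(1) b(1) unfolding punctured_space_def by blast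
    \<comment> \<open>The strict inequality is a property of the line: right scaling by
      \<open>c\<close> multiplies both norms by \<open>norm c\<close>. The reversed inequality
      defines \<open>W k i\<close>, so the images are disjoint.\<close>
    define W where "W i k = {a \<in> punctured_space n. norm (a k) < norm (a i)}" for i k
    have "openin ?P (W i k)" if "i \<in> {1..n + 1}" "k \<in> {1..n + 1}" for i k
    proof -
      have "continuous_map ?P euclidean (\<lambda>a. norm (a i) - norm (a k))"
        by (intro continuous_map_diff continuous_map_norm continuous_map_punctured_proj that)
      from openin_continuous_map_preimage[OF this, of "{0<..}"] show ?thesis
        unfolding topspace_punctured W_def by simp
    qed
    then have W: "openin (HP_space n) (right_line n ` W i k)" if "i \<in> {1..n + 1}" "k \<in> {1..n + 1}" for i k
      using open_map_right_line that unfolding open_map_def by blast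
    have "disjnt (right_line n ` W i k) (right_line n ` W k i)"
      unfolding disjnt_iff
    proof (intro allI notI, elim conjE imageE)
      fix N x y
      assume x: "x \<in> W i k" "N = right_line n x" and y: "y \<in> W k i" "N = right_line n y"
      then obtain c where "c \<noteq> 0" "y = (\<lambda>h\<in>{1..n + 1}. x h * c)"
        using right_line_eqD[of x n y] unfolding W_def by auto
      then show False
        using x(1) y(1) i(1) k(1) by (auto simp: W_def norm_mult)
    qed
    moreover have "a k = 0" "b i = 0"
      using False i k by blast+
    then have "a \<in> W i k" "b \<in> W k i"
      using a(1) b(1) i(2) k(2) by (simp_all add: W_def)
    then have "L \<in> right_line n ` W i k" "M \<in> right_line n ` W k i"
      using a(2) b(2) by blast+
    ultimately show ?thesis
      using W i k by blast
  qed
qed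

section \<open>Transition functions\<close>

lemma imaginary_unit_square: "J \<in> imaginary_units \<Longrightarrow> J * J = - 1"
  by (simp add: imaginary_units_def power2_eq_square)

text \<open>The unit is the imaginary part divided by its norm \<open>r\<close>; for real
  \<open>q\<close> this norm is 0 and an arbitrary fixed unit is taken.\<close>

lemma quat_slice_decomposition:
  obtains x y J where "J \<in> imaginary_units" "q = of_real x + of_real y * J"
proof -
  define r where "r = sqrt ((qIm1 q)\<^sup>2 + (qIm2 q)\<^sup>2 + (qIm3 q)\<^sup>2)"
  have r2: "r * r = qIm1 q * qIm1 q + qIm2 q * qIm2 q + qIm3 q * qIm3 q"
    unfolding r_def by (simp add: power2_eq_square)
  show thesis
  proof (cases "r = 0")
    case True
    then have "q = of_real (qRe q) + of_real 0 * Quat 0 1 0 0"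
      using r2 unfolding r_def
      by (auto simp: quat_eq_iff of_real_def add_nonneg_eq_0_iff)
    moreover have "Quat 0 1 0 0 \<in> imaginary_units"
      by (simp add: imaginary_units_def power2_eq_square times_quat_def quat_eq_iff)
    ultimately show thesis
      using that[of "Quat 0 1 0 0" "qRe q" 0] by simp
  next
    case False
    let ?J = "Quat 0 (qIm1 q / r) (qIm2 q / r) (qIm3 q / r)"
    have "qIm1 q * qIm1 q / (r * r) + qIm2 q * qIm2 q / (r * r) + qIm3 q * qIm3 q / (r * r) = 1"
      unfolding add_divide_distrib[symmetric] r2[symmetric] using False by simp
    then have "?J \<in> imaginary_units"
      by (simp add: imaginary_units_def power2_eq_square times_quat_def quat_eq_iff)
    moreover have "q = of_real (qRe q) + of_real r * ?J"
      using False by (simp add: quat_eq_iff of_real_def)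
    ultimately show thesis
      by (rule that)
  qed
qed

text \<open>As \<open>J * J = - 1\<close>, the slice of \<open>J\<close> is a copy of the complex
  numbers, and the second factor is the conjugate of the first.\<close>

lemma slice_mult_conj:
  assumes "J \<in> imaginary_units"
  shows "(of_real x + of_real y * J) * (of_real x - of_real y * J) = (of_real (x\<^sup>2 + y\<^sup>2) :: quat)"
  by (simp add: of_real_def algebra_simps imaginary_unit_square[OF assms] power2_eq_square flip: scaleR_add_left)

lemma slice_eq_0_iff:
  assumes "J \<in> imaginary_units"
  shows "of_real x + of_real y * J = 0 \<longleftrightarrow> x = 0 \<and> y = 0"
proof
  assume "of_real x + of_real y * J = 0"
  then have "of_real (x\<^sup>2 + y\<^sup>2) = (0 :: quat)"
    using slice_mult_conj[OF assms, of x y] by (metis mult_zero_left)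
  then show "x = 0 \<and> y = 0"
    by (simp only: of_real_eq_0_iff sum_power2_eq_zero_iff)
qed simp

lemma slice_inverse:
  assumes "J \<in> imaginary_units"
  shows "inverse (of_real x + of_real y * J) =
    of_real (Re (inverse (Complex x y))) + of_real (Im (inverse (Complex x y))) * J"
\<comment> \<open>At the origin both inverses are 0 by convention, so the formula holds there
  too.\<close>
proof (cases "x = 0 \<and> y = 0")
  case False
  then have "x\<^sup>2 + y\<^sup>2 \<noteq> 0"
    by (simp add: sum_power2_eq_zero_iff)
  then have "(of_real x + of_real y * J) * ((1 / (x\<^sup>2 + y\<^sup>2)) *\<^sub>R (of_real x - of_real y * J)) = 1"
    using slice_mult_conj[OF assms, of x y] by (simp add: of_real_def)
  then have "inverse (of_real x + of_real y * J) = (1 / (x\<^sup>2 + y\<^sup>2)) *\<^sub>R (of_real x - of_real y * J)"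
    by (rule inverse_unique)
  then show ?thesis
    by (simp add: of_real_def scaleR_diff_right)
qed auto

section \<open>Ratios of two affine coordinates\<close>

text \<open>All but two factors are 1. A position outside \<open>{1..n}\<close>, in particular 0,
  contributes 1, in accordance with \<open>affine_coord q 0 = 1\<close>.\<close>

lemma prod_list_two:
  fixes a b :: "'a::monoid_mult"
  assumes "l < m"
  shows "prod_list (map (\<lambda>h. if h = l then a else if h = m then b else 1) [1..<Suc n]) =
    (if l \<in> {1..n} then a else 1) * (if m \<in> {1..n} then b else 1)"
  using assms by (induction n) auto

lemma prod_list_two_rev:
  fixes a b :: "'a::monoid_mult"
  assumes "m < l"
  shows "prod_list (map (\<lambda>h. if h = l then a else if h = m then b else 1) (rev [1..<Suc n])) =
    (if l \<in> {1..n} then a else 1) * (if m \<in> {1..n} then b else 1)"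
  using assms by (induction n) auto

lemma slice_regular_ratio:
  assumes D: "openin (cspace n) D" and nz: "\<And>z. z \<in> D \<Longrightarrow> m \<noteq> 0 \<Longrightarrow> z m \<noteq> 0"
    and lm: "l \<le> n" "m \<le> n" "l \<noteq> m"
  defines "f \<equiv> \<lambda>q. affine_coord q l * inverse (affine_coord q m)"
  shows "left_slice_regular n D f \<or> right_slice_regular n D f"
proof -
  \<comment> \<open>The complex model: the identity at \<open>l\<close>, the inverse at
    \<open>m\<close> and 1 elsewhere. \<open>\<Phi>\<close> is its quaternionic counterpart, and the
    two match on slices by \<open>slice_inverse\<close>.\<close>
  define \<phi> :: "nat \<Rightarrow> complex \<Rightarrow> complex"
    where "\<phi> h = (if h = l then (\<lambda>w. w) else if h = m then inverse else (\<lambda>w. 1))" for h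
  define \<Phi> :: "nat \<Rightarrow> quat \<Rightarrow> quat"
    where "\<Phi> h = (if h = l then (\<lambda>q. q) else if h = m then inverse else (\<lambda>q. 1))" for h
  have C1: "Ck_on n 1 D (\<lambda>z. \<phi> h (z h))" if h: "h \<in> {1..n}" for h
  proof -
    consider "h = l" | "h = m" "h \<noteq> l" | "h \<noteq> l" "h \<noteq> m"
      by blast
    then show ?thesis
    proof cases
      case 1
      then show ?thesis
        by (intro Ck_on_cong[OF D _ Ck_on_proj[OF D h]]) (simp add: \<phi>_def)
    next
      case 2
      have "Ck_on n 1 D (\<lambda>z. inverse (z h))"
        by (rule Ck_on_inverse[OF D Ck_on_proj[OF D h]]) (use nz h 2 in auto)
      then show ?thesis
        by (rule Ck_on_cong[OF D, rotated]) (simp add: \<phi>_def 2 lm(3)[symmetric])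
    next
      case 3
      then show ?thesis
        by (intro Ck_on_cong[OF D _ Ck_on_const[OF D, of 1 1]]) (simp add: \<phi>_def)
    qed
  qed
  have holo: "\<phi> h field_differentiable at (z h)" if "h \<in> {1..n}" "z \<in> D" for h z
    unfolding \<phi>_def using nz[OF that(2)] that(1)
    by (auto intro: field_differentiable_inverse field_differentiable_ident[unfolded id_def] field_differentiable_const)
  have cnj: "\<phi> h (cnj w) = cnj (\<phi> h w)" for h w
    by (simp add: \<phi>_def)
  have \<Phi>: "\<Phi> h (of_real x + of_real y * J) = of_real (Re (\<phi> h (Complex x y))) + of_real (Im (\<phi> h (Complex x y))) * J"
    if "J \<in> imaginary_units" for h x y J
    unfolding \<Phi>_def \<phi>_def using slice_inverse[OF that] by simp
  have eq: "(\<lambda>h. \<Phi> h (q h)) = (\<lambda>h. if h = l then q l else if h = m then inverse (q m) else 1)" for q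
    by (auto simp: \<Phi>_def)
  have f: "f q = (if l \<in> {1..n} then q l else 1) * (if m \<in> {1..n} then inverse (q m) else 1)" for q
    using lm by (simp add: f_def affine_coord_def)
  show ?thesis
  proof (cases "l < m")
    case True
    have "left_slice_regular n D (\<lambda>q. prod_list (map (\<lambda>h. \<Phi> h (q h)) [1..<Suc n]))"
      by (rule product_slice_regular(1)[where \<phi> = \<phi>]) (simp_all only: D C1 holo cnj \<Phi>)
    moreover have "(\<lambda>q. prod_list (map (\<lambda>h. \<Phi> h (q h)) [1..<Suc n])) = f"
      unfolding eq prod_list_two[OF True] f [abs_def] ..
    ultimately show ?thesis
      by simp
  next
    case False
    then have "m < l"
      using lm by simp
    have "right_slice_regular n D (\<lambda>q. prod_list (map (\<lambda>h. \<Phi> h (q h)) (rev [1..<Suc n])))"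
      by (rule product_slice_regular(2)[where \<phi> = \<phi>]) (simp_all only: D C1 holo cnj \<Phi>)
    moreover have "(\<lambda>q. prod_list (map (\<lambda>h. \<Phi> h (q h)) (rev [1..<Suc n]))) = f"
      unfolding eq prod_list_two_rev[OF \<open>m < l\<close>] f [abs_def] ..
    ultimately show ?thesis
      by simp
  qed
qed

lemma Ck_on_affine_coord:
  assumes "openin (cspace n) X" "l \<le> n"
  shows "Ck_on n k X (\<lambda>q. affine_coord q l)"
proof (cases "l = 0")
  case True
  then show ?thesis
    using Ck_on_const[OF assms(1), of k 1] by (simp add: affine_coord_def)
next
  case False
  then show ?thesis
    using Ck_on_proj[OF assms(1), of l k] assms(2) by (simp add: affine_coord_def)
qed

lemma slice_regular_cong:
  assumes "\<And>q. q \<in> Omega n D \<Longrightarrow> f q = g q"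
  shows "left_slice_regular n D f \<longleftrightarrow> left_slice_regular n D g"
    and "right_slice_regular n D f \<longleftrightarrow> right_slice_regular n D g"
proof -
  have "f (qpoint n x y J) = g (qpoint n x y J)"
    if "(\<forall>h\<in>{1..n}. J h \<in> imaginary_units) \<and> cpoint n x y \<in> D" for x y J
    using that by (intro assms) (auto simp: Omega_def)
  then show "left_slice_regular n D f \<longleftrightarrow> left_slice_regular n D g"
    and "right_slice_regular n D f \<longleftrightarrow> right_slice_regular n D g"
    unfolding left_slice_regular_def right_slice_regular_def by simp_all
qed

section \<open>Transition domains and formulas\<close>

text \<open>Polymorphic in the scalars: the complex instance is the domain of the stem functions,
  the quaternionic one the transition domain. Index 0 stands for the coordinate 1 and imposes no
  condition.\<close>

definition coord_nonzero :: "nat \<Rightarrow> nat \<Rightarrow> (nat \<Rightarrow> 'a::zero) set"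
  where "coord_nonzero n m = {z \<in> {1..n} \<rightarrow>\<^sub>E UNIV. m \<noteq> 0 \<longrightarrow> z m \<noteq> 0}"

lemma openin_coord_nonzero:
  assumes "m \<le> n"
  shows "openin (cspace n) (coord_nonzero n m :: (nat \<Rightarrow> 'a::real_normed_vector) set)"
proof (cases "m = 0")
  case True
  then show ?thesis
    using openin_topspace[of "cspace n"] by (simp add: coord_nonzero_def topspace_cspace)
next
  case False
  then have "m \<in> {1..n}"
    using assms by simp
  from openin_continuous_map_preimage[OF continuous_map_cspace_proj[OF this], of "- {0 :: 'a}"] False
  show ?thesis
    by (simp add: coord_nonzero_def topspace_cspace open_Compl)
qed

text \<open>Every quaternion lies on some slice, and a point of a slice vanishes exactly when its
  complex counterpart does.\<close>

lemma Omega_coord_nonzero: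
  assumes "m \<le> n"
  shows "Omega n (coord_nonzero n m) = coord_nonzero n m"
proof (intro equalityI subsetI)
  fix q
  assume "q \<in> Omega n (coord_nonzero n m)"
  then obtain x y J where "q = qpoint n x y J" "\<forall>h\<in>{1..n}. J h \<in> imaginary_units" "cpoint n x y \<in> coord_nonzero n m"
    unfolding Omega_def by blast
  then show "q \<in> coord_nonzero n m"
    using assms by (auto simp: coord_nonzero_def qpoint_def cpoint_def slice_eq_0_iff complex_eq_iff)
next
  fix q :: "nat \<Rightarrow> quat"
  assume q: "q \<in> coord_nonzero n m"
  have "\<forall>h. \<exists>x y J. J \<in> imaginary_units \<and> q h = of_real x + of_real y * J"
    using quat_slice_decomposition by metis
  then obtain x y J where xyJ: "\<And>h. J h \<in> imaginary_units" "\<And>h. q h = of_real (x h) + of_real (y h) * J h"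
    by metis
  have "q = qpoint n x y J"
    unfolding qpoint_def xyJ(2)[symmetric] using q by (simp add: coord_nonzero_def PiE_def extensional_restrict)
  moreover have "cpoint n x y \<in> coord_nonzero n m"
    using q assms by (auto simp: coord_nonzero_def cpoint_def xyJ complex_eq_iff)
  ultimately show "q \<in> Omega n (coord_nonzero n m)"
    unfolding Omega_def using xyJ(1) by blast
qed

text \<open>A line lies in the domain \<open>j\<close> when its homogeneous coordinate
  \<open>j\<close> is nonzero; for the lift from chart \<open>i\<close> this is the coordinate at
  \<open>affine_index i j\<close>.\<close>

lemma transition_image:
  assumes i: "i \<in> {1..n + 1}" and j: "j \<in> {1..n + 1}"
  shows "natural_coords n i ` (natural_domain n i \<inter> natural_domain n j) = coord_nonzero n (affine_index i j)"
proof -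
  have lift_in: "right_line n (affine_lift n i q) \<in> natural_domain n j \<longleftrightarrow>
      (affine_index i j \<noteq> 0 \<longrightarrow> q (affine_index i j) \<noteq> 0)" for q
    using j by (simp only: right_line_in_natural_domain_iff[OF affine_lift_punctured[OF i]])
      (simp add: affine_lift_def affine_coord_def)
  show ?thesis
  proof (intro equalityI subsetI)
    fix q :: "nat \<Rightarrow> quat"
    assume "q \<in> natural_coords n i ` (natural_domain n i \<inter> natural_domain n j)"
    then obtain L where "q = natural_coords n i L" "L \<in> natural_domain n i" "L \<in> natural_domain n j"
      by blast
    then show "q \<in> coord_nonzero n (affine_index i j)"
      using lift_in[of q] affine_lift_natural_coords[OF i] natural_coords_in[of n i L] by (simp add: coord_nonzero_def)
  next
    fix q :: "nat \<Rightarrow> quat"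
    assume "q \<in> coord_nonzero n (affine_index i j)"
    then show "q \<in> natural_coords n i ` (natural_domain n i \<inter> natural_domain n j)"
      using lift_in[of q] affine_lift_in_domain[OF i, of q] natural_coords_affine_lift[OF i, of q]
      unfolding coord_nonzero_def by (metis (mono_tags, lifting) IntI image_eqI mem_Collect_eq)
  qed
qed

text \<open>The inverse of chart \<open>i\<close> is the line of the lift, and chart
  \<open>j\<close> divides the coordinates of this lift on the right by its coordinate
  \<open>j\<close>.\<close>

lemma transition_map_eq:
  assumes i: "i \<in> {1..n + 1}" and j: "j \<in> {1..n + 1}" and q: "q \<in> coord_nonzero n (affine_index i j)"
  shows "(natural_coords n j \<circ> inv_into (natural_domain n i) (natural_coords n i)) q =
    (\<lambda>k\<in>{1..n}. affine_coord q (affine_index i (if k < j then k else k + 1)) *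
      inverse (affine_coord q (affine_index i j)))"
proof -
  have "inj_on (natural_coords n i) (natural_domain n i)"
    by (rule inj_on_inverseI[where g = "\<lambda>q. right_line n (affine_lift n i q)"])
      (rule affine_lift_natural_coords[OF i])
  then have "inv_into (natural_domain n i) (natural_coords n i) q = right_line n (affine_lift n i q)"
    using affine_lift_in_domain[OF i] natural_coords_affine_lift[OF i] q
    by (intro inv_into_f_eq) (auto simp: coord_nonzero_def)
  moreover have nz: "affine_lift n i q j \<noteq> 0"
    using j q by (simp add: affine_lift_def affine_coord_def coord_nonzero_def)
  ultimately have "(natural_coords n j \<circ> inv_into (natural_domain n i) (natural_coords n i)) q =
      (\<lambda>k\<in>{1..n}. affine_lift n i q (if k < j then k else k + 1) * inverse (affine_lift n i q j))"
    by (simp only: o_apply natural_coords_right_line[OF affine_lift_punctured[OF i] j nz])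
  then show ?thesis
    using j by (auto simp: affine_lift_def intro!: restrict_ext)
qed

lemma slice_regular_map_transition:
  assumes i: "i \<in> {1..n + 1}" and j: "j \<in> {1..n + 1}"
  shows "slice_regular_map n n
    (natural_coords n i ` (natural_domain n i \<inter> natural_domain n j))
    (natural_coords n j \<circ> inv_into (natural_domain n i) (natural_coords n i))"
proof -
  define m where "m = affine_index i j"
  define T where "T = natural_coords n j \<circ> inv_into (natural_domain n i) (natural_coords n i)"
  define l where "l k = affine_index i (if k < j then k else k + 1)" for k
  have m: "m \<le> n"
    unfolding m_def by (rule affine_index_le[OF i j])
  have l: "l k \<le> n" "l k \<noteq> m" if k: "k \<in> {1..n}" for k
  proof -
    show "l k \<le> n"
      unfolding l_def by (rule affine_index_le[OF i]) (use k in auto)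
    \<comment> \<open>The homogeneous index attached to \<open>k\<close> skips \<open>j\<close>, so
      injectivity of \<open>affine_index i\<close> separates the two positions.\<close>
    show "l k \<noteq> m"
      using affine_index_inj[of i "if k < j then k else k + 1" j] i j k
      by (auto simp: l_def m_def split: if_splits)
  qed
  have T: "T q k = affine_coord q (l k) * inverse (affine_coord q m)"
    if "q \<in> coord_nonzero n m" "k \<in> {1..n}" for q k
    using transition_map_eq[OF i j] that by (simp add: T_def m_def l_def)
  have X: "openin (cspace n) (coord_nonzero n m :: (nat \<Rightarrow> quat) set)"
    and D: "openin (cspace n) (coord_nonzero n m :: (nat \<Rightarrow> complex) set)"
    using openin_coord_nonzero[OF m] by blast+
  have "smooth_map_on n n (coord_nonzero n m) T"
    unfolding smooth_map_on_def
  proof (intro conjI ballI allI)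
    show "T \<in> coord_nonzero n m \<rightarrow> ({1..n} \<rightarrow>\<^sub>E UNIV)"
      unfolding T_def o_def by (rule Pi_I) (rule natural_coords_in)
    fix k d
    assume k: "k \<in> {1..n}"
    have "Ck_on n d (coord_nonzero n m) (\<lambda>q. affine_coord q (l k) * inverse (affine_coord q m))"
      by (intro Ck_on_mult[OF X] Ck_on_inverse[OF X] Ck_on_affine_coord[OF X] l(1)[OF k] m)
        (simp add: coord_nonzero_def affine_coord_def)
    then show "Ck_on n d (coord_nonzero n m) (\<lambda>q. T q k)"
      by (rule Ck_on_cong[OF X, rotated]) (simp only: T[OF _ k])
  qed
  moreover have "left_slice_regular n (coord_nonzero n m) (\<lambda>q. T q k) \<or> right_slice_regular n (coord_nonzero n m) (\<lambda>q. T q k)"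
    if k: "k \<in> {1..n}" for k
  proof -
    \<comment> \<open>The ratio formula for \<open>T\<close> is available only on the transition
      domain; this suffices because slice regularity depends only on values on
      \<open>Omega\<close>.\<close>
    have "T q k = affine_coord q (l k) * inverse (affine_coord q m)" if "q \<in> Omega n (coord_nonzero n m)" for q
      using that unfolding Omega_coord_nonzero[OF m] by (rule T[OF _ k])
    from slice_regular_cong[of n "coord_nonzero n m" "\<lambda>q. T q k", OF this]
    show ?thesis
      using slice_regular_ratio[OF D _ l(1)[OF k] m l(2)[OF k]] by (simp add: coord_nonzero_def)
  qed
  moreover have "conj_invariant n (coord_nonzero n m)"
    by (auto simp: conj_invariant_def coord_nonzero_def PiE_def extensional_def)
  ultimately have "slice_regular_map n n (coord_nonzero n m) T"
    unfolding slice_regular_map_def using D Omega_coord_nonzero[OF m] by (intro exI[of _ "coord_nonzero n m"]) simp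
  then show ?thesis
    unfolding transition_image[OF i j] T_def m_def .
qed

section \<open>The natural atlas\<close>

theorem mainTheorem3:
  fixes n :: nat
  shows "quaternionic_regular_manifold n (HP_space n) \<and>
    quaternionic_regular_atlas n (HP_space n) (natural_chart n ` {1..n + 1}) \<and>
    (\<forall>i\<in>{1..n + 1}. \<forall>j\<in>{1..n + 1}.
       slice_regular_map n n
         (natural_coords n i ` (natural_domain n i \<inter> natural_domain n j))
         (natural_coords n j \<circ> inv_into (natural_domain n i) (natural_coords n i)))"
proof -
  have slice: "slice_regular_map n n (transition_domain c d) (transition_map c d)"
    if "c \<in> natural_chart n ` {1..n + 1}" "d \<in> natural_chart n ` {1..n + 1}" for c d
  proof -
    obtain i j where "c = natural_chart n i" "d = natural_chart n j" "i \<in> {1..n + 1}" "j \<in> {1..n + 1}"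
      using \<open>c \<in> _\<close> \<open>d \<in> _\<close> by blast
    then show ?thesis
      using slice_regular_map_transition
      by (simp only: natural_chart_def transition_domain_def transition_map_def prod.case)
  qed
  have "\<Union> (fst ` natural_chart n ` {1..n + 1}) = topspace (HP_space n)"
    unfolding topspace_HP_space Union_natural_domain[symmetric] by (simp add: natural_chart_def image_image)
  \<comment> \<open>Smoothness is part of \<open>slice_regular_map\<close>, so the differentiable
    atlas comes from the same lemma.\<close>
  moreover have "smooth_map_on n n (transition_domain c d) (transition_map c d)"
    if "c \<in> natural_chart n ` {1..n + 1}" "d \<in> natural_chart n ` {1..n + 1}" for c d
    using slice[OF that] unfolding slice_regular_map_def by blast
  ultimately have "differentiable_atlas n (HP_space n) (natural_chart n ` {1..n + 1})"
    unfolding differentiable_atlas_def by (intro conjI ballI) (auto simp only: chart_on_natural_chart)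
  then have "quaternionic_regular_atlas n (HP_space n) (natural_chart n ` {1..n + 1})"
    unfolding quaternionic_regular_atlas_def using slice by blast
  then show ?thesis
    unfolding quaternionic_regular_manifold_def
    by (intro conjI ballI exI[of _ "natural_chart n ` {1..n + 1}"] Hausdorff_space_HP_space
        second_countable_HP_space slice_regular_map_transition)
qed

end
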